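(* Let $k,l$ denote integers with $k,l\ge 2$. The following statements hold: 1) There exists no $1$-Platonic graph of any type $(k,l)$. 2) If $G$ is a $2$-Platonic graph of type $(k,l)$ with two exceptional faces of degrees $u$ and $v$, then $u=v$. 3) If $G$ is a $2$-Platonic graph of type $(k,l)$ with one exceptional vertex of degree $u$ and one exceptional face of degree $v$, then either $k=l=3$ and $u=v$, or $G$ is a uniform graph of type $(k,l)$ and $u/k=v/l$.
   Context: "Graph" means a finite connected plane graph (embedded in the sphere) with at least one edge, possibly with multiple edges and loops. The degree of a vertex counts each loop twice; the degree of a face is the length of its boundary walk (an edge having the same face on both sides is counted twice). For integers $k,l\ge2$, a graph is $1$-Platonic (respectively $2$-Platonic) of type $(k,l)$ if all its vertex degrees equal $k$ and all its face degrees equal $l$, with exactly one exception (respectively exactly two exceptions) among the vertices and faces; here an exceptional vertex is one of degree different from $k$ and an exceptional face is one of degree different from $l$. A graph is uniform of type $(k,l)$ if all its vertex degrees are divisible by $k$ and all its face degrees are divisible by $l$. *)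

theory Defs
  imports "HOL-Analysis.Analysis"
begin

type_synonym point = "real ^ 3"

(* A dart is an edge together with one of its two directions, given as a parametrised path. *)
type_synonym dart = "real \<Rightarrow> point"

(* An edge is represented by its two darts g and reversepath g.  The boundary walks of the
   faces are carried along, so that the degree of a face is the length of its walk. *)
record plane_graph =
  verts :: "point set"
  darts :: "dart set"
  bwalk :: "point set \<Rightarrow> dart list"

definition support :: "plane_graph \<Rightarrow> point set" where
  "support G = verts G \<union> (\<Union>g\<in>darts G. path_image g)"

definition faces :: "plane_graph \<Rightarrow> point set set" where
  "faces G = components (sphere 0 1 - support G)"

definition edges :: "plane_graph \<Rightarrow> point set set" where
  "edges G = path_image ` darts G"

(* simple_path allows pathstart g = pathfinish g, i.e. loops. *)
definition embedded_graph :: "plane_graph \<Rightarrow> bool" where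
  "embedded_graph G \<longleftrightarrow>
     finite (verts G) \<and> verts G \<subseteq> sphere 0 1 \<and>
     finite (darts G) \<and> darts G \<noteq> {} \<and>
     (\<forall>g\<in>darts G. simple_path g \<and> path_image g \<subseteq> sphere 0 1 \<and>
        pathstart g \<in> verts G \<and> pathfinish g \<in> verts G \<and>
        g ` {0<..<1} \<inter> verts G = {} \<and> reversepath g \<in> darts G) \<and>
     (\<forall>g\<in>darts G. \<forall>h\<in>darts G. h \<noteq> g \<longrightarrow> h \<noteq> reversepath g \<longrightarrow>
        g ` {0<..<1} \<inter> h ` {0<..<1} = {}) \<and>
     connected (support G)"

definition closed_walk :: "dart list \<Rightarrow> bool" where
  "closed_walk w \<longleftrightarrow> w \<noteq> [] \<and>
     (\<forall>i<length w. pathfinish (w ! i) = pathstart (w ! (Suc i mod length w)))"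

(* If a boundary walk arrives at a vertex along g and leaves it along h, then the outgoing
   darts reversepath g and h are neighbours in the cyclic order around that vertex. *)
definition turn :: "plane_graph \<Rightarrow> (dart \<times> dart) set" where
  "turn G = {(reversepath (bwalk G f ! i), bwalk G f ! (Suc i mod length (bwalk G f))) | f i.
               f \<in> faces G \<and> i < length (bwalk G f)}"

(* All walks keep their face on the same side (with respect to an orientation of the sphere),
   so every dart is traversed exactly once, and the walk of f runs along e once for each side
   of e on which f lies.  A face has empty interior in the ambient space, hence incidence with
   an edge is expressed by closure f instead of frontier f.  The last condition says that
   turning from corner to corner around a vertex one meets all darts leaving it. *)
definition boundary_walks :: "plane_graph \<Rightarrow> bool" where
  "boundary_walks G \<longleftrightarrow>
     (\<forall>f\<in>faces G. set (bwalk G f) \<subseteq> darts G \<and> distinct (bwalk G f) \<and> closed_walk (bwalk G f)) \<and>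
     (\<forall>g\<in>darts G. \<exists>!f. f \<in> faces G \<and> g \<in> set (bwalk G f)) \<and>
     (\<forall>g\<in>darts G. \<forall>f\<in>faces G. path_image g \<subseteq> closure f \<longleftrightarrow>
        g \<in> set (bwalk G f) \<or> reversepath g \<in> set (bwalk G f)) \<and>
     (\<forall>g\<in>darts G. \<forall>h\<in>darts G. pathstart g = pathstart h \<longrightarrow> (g, h) \<in> (turn G)\<^sup>*)"

definition graph :: "plane_graph \<Rightarrow> bool" where
  "graph G \<longleftrightarrow> embedded_graph G \<and> boundary_walks G"

(* A loop at x contributes both of its darts. *)
definition vertex_degree :: "plane_graph \<Rightarrow> point \<Rightarrow> nat" where
  "vertex_degree G x = card {g \<in> darts G. pathstart g = x}"

definition face_degree :: "plane_graph \<Rightarrow> point set \<Rightarrow> nat" where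
  "face_degree G f = length (bwalk G f)"

definition exceptional_vertices :: "nat \<Rightarrow> plane_graph \<Rightarrow> point set" where
  "exceptional_vertices k G = {x \<in> verts G. vertex_degree G x \<noteq> k}"

definition exceptional_faces :: "nat \<Rightarrow> plane_graph \<Rightarrow> point set set" where
  "exceptional_faces l G = {f \<in> faces G. face_degree G f \<noteq> l}"

definition platonic :: "nat \<Rightarrow> nat \<Rightarrow> nat \<Rightarrow> plane_graph \<Rightarrow> bool" where
  "platonic n k l G \<longleftrightarrow> graph G \<and>
     finite (exceptional_vertices k G) \<and> finite (exceptional_faces l G) \<and>
     card (exceptional_vertices k G) + card (exceptional_faces l G) = n"

definition uniform :: "nat \<Rightarrow> nat \<Rightarrow> plane_graph \<Rightarrow> bool" where
  "uniform k l G \<longleftrightarrow> graph G \<and>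
     (\<forall>x\<in>verts G. k dvd vertex_degree G x) \<and> (\<forall>f\<in>faces G. l dvd face_degree G f)"

lemma path_image_eq_iff_dart:
  assumes "embedded_graph G" "g \<in> darts G" "h \<in> darts G"
  shows "path_image h = path_image g \<longleftrightarrow> h = g \<or> h = reversepath g"
proof
  assume eq: "path_image h = path_image g"
  show "h = g \<or> h = reversepath g"
  proof (rule ccontr)
    assume "\<not> ?thesis"
    then have dis: "g ` {0<..<1} \<inter> h ` {0<..<1} = {}"
      using assms unfolding embedded_graph_def by blast
    have "g (1/2) \<in> path_image g"
      unfolding path_image_def by auto
    then have "g (1/2) \<in> path_image h" using eq by simp
    then obtain t where t: "t \<in> {0..1}" "g (1/2) = h t"
      unfolding path_image_def by auto
    have V: "h 0 \<in> verts G" "h 1 \<in> verts G" "g ` {0<..<1} \<inter> verts G = {}"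
      using assms by (simp_all add: embedded_graph_def pathstart_def pathfinish_def)
    have g: "g (1/2) \<in> g ` {0<..<1}" by auto
    then have "t \<noteq> 0" "t \<noteq> 1" using V t by auto
    then have "h t \<in> h ` {0<..<1}" using t by auto
    then show False using g dis t by auto
  qed
qed auto

(* Face degrees are determined by the embedding alone: an edge on the boundary of f counts
   once, and once more if no other face is incident with it. *)
lemma face_degree_alt:
  assumes G: "graph G" and f: "f \<in> faces G"
  shows "face_degree G f = card {e \<in> edges G. e \<subseteq> closure f} +
     card {e \<in> edges G. e \<subseteq> closure f \<and> (\<forall>f'\<in>faces G. e \<subseteq> closure f' \<longrightarrow> f' = f)}"
    (is "_ = card ?A + card ?B")
proof -
  let ?S = "set (bwalk G f)"
  have eg: "embedded_graph G" and bw: "boundary_walks G"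
    using G by (auto simp: graph_def)
  have SD: "?S \<subseteq> darts G" and dist: "distinct (bwalk G f)"
    using bw f by (auto simp: boundary_walks_def)
  have rev: "reversepath g \<in> darts G" "g \<noteq> reversepath g" if "g \<in> darts G" for g
  proof -
    show "reversepath g \<in> darts G" using eg that by (auto simp: embedded_graph_def)
    have "simple_path g" using eg that by (auto simp: embedded_graph_def)
    then have "g (1/4) \<noteq> g (3/4)"
      unfolding simple_path_def loop_free_def by fastforce
    then show "g \<noteq> reversepath g"
      by (auto simp: reversepath_def fun_eq_iff intro!: exI[of _ "1/4"])
  qed
  have inc: "path_image g \<subseteq> closure f' \<longleftrightarrow> g \<in> set (bwalk G f') \<or> reversepath g \<in> set (bwalk G f')"
    if "g \<in> darts G" "f' \<in> faces G" for g f'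
    using bw that unfolding boundary_walks_def by blast
  have ex1: "\<exists>!f'. f' \<in> faces G \<and> g \<in> set (bwalk G f')" if "g \<in> darts G" for g
    using bw that by (simp add: boundary_walks_def)
  have uniq: "f' = f''" if "g \<in> darts G" "f' \<in> faces G" "f'' \<in> faces G"
    "g \<in> set (bwalk G f')" "g \<in> set (bwalk G f'')" for g f' f''
    using ex1[OF that(1)] that by (elim ex1E) metis
  have ex: "\<exists>f'\<in>faces G. g \<in> set (bwalk G f')" if "g \<in> darts G" for g
    using ex1[OF that] by (elim ex1E) blast
  have finA: "finite ?A"
    using eg by (auto simp: embedded_graph_def edges_def)
  have fib: "card {g \<in> ?S. path_image g = e} = 1 + (if e \<in> ?B then 1 else 0)"
    if e: "e \<in> ?A" for e
  proof -
    obtain g where g: "g \<in> darts G" "e = path_image g" "g \<in> ?S"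
    proof -
      obtain g where "g \<in> darts G" "e = path_image g"
        using e by (auto simp: edges_def)
      then show ?thesis
        using that[of g] that[of "reversepath g"] e f inc[of g f] rev[of g] by auto
    qed
    have S: "{h \<in> ?S. path_image h = e} = {g, reversepath g} \<inter> ?S"
      using path_image_eq_iff_dart[OF eg g(1)] SD g by auto
    have "e \<in> ?B \<longleftrightarrow> reversepath g \<in> ?S"
    proof
      assume B: "e \<in> ?B"
      obtain f' where f': "f' \<in> faces G" "reversepath g \<in> set (bwalk G f')"
        using ex rev g by blast
      then have "e \<subseteq> closure f'" using inc g by blast
      then show "reversepath g \<in> ?S" using B f' by auto
    next
      assume R: "reversepath g \<in> ?S"
      have "f' = f" if "f' \<in> faces G" "e \<subseteq> closure f'" for f'
        using inc[of g f'] uniq[of g f' f] uniq[of "reversepath g" f' f] rev[of g] g R that f by auto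
      then show "e \<in> ?B" using e by auto
    qed
    then show ?thesis
      unfolding S using rev(2)[OF g(1)] g(3) by (auto simp: Int_insert_left)
  qed
  have "?S = (\<Union>e\<in>?A. {g \<in> ?S. path_image g = e})"
    using SD inc f by (auto simp: edges_def)
  then have "card ?S = card (\<Union>e\<in>?A. {g \<in> ?S. path_image g = e})" by simp
  also have "\<dots> = (\<Sum>e\<in>?A. card {g \<in> ?S. path_image g = e})"
    by (rule card_UN_disjoint) (use finA in auto)
  also have "\<dots> = (\<Sum>e\<in>?A. 1 + (if e \<in> ?B then 1 else 0))"
    by (rule sum.cong[OF refl]) (use fib in auto)
  also have "\<dots> = card ?A + (\<Sum>e\<in>?A. if e \<in> ?B then 1 else 0)"
    by (subst sum.distrib) (simp only: card_eq_sum)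
  also have "(\<Sum>e\<in>?A. if e \<in> ?B then 1 else (0::nat)) = (\<Sum>e\<in>?A \<inter> ?B. 1)"
    by (rule sum.inter_restrict[OF finA, symmetric])
  also have "\<dots> = card (?A \<inter> ?B)"
    by (simp only: card_eq_sum)
  also have "?A \<inter> ?B = ?B" by auto
  finally show ?thesis
    using dist by (simp add: face_degree_def distinct_card)
qed

end

theory Submission
  imports Defs
begin

text \<open>
  All three statements follow from one fact about a plane graph in which all vertices have degree
  \<open>k\<close> and all faces have degree \<open>l\<close>, except for two cells (a cell is a vertex or a face) of degrees
  \<open>u\<^sub>1, u\<^sub>2\<close> in place of \<open>k\<^sub>1, k\<^sub>2 \<in> {k, l}\<close>: then \<open>u\<^sub>1 / k\<^sub>1 = u\<^sub>2 / k\<^sub>2\<close>, and there is one \<open>h\<close> with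
  \<open>lcm u\<^sub>i k\<^sub>i = h u\<^sub>i\<close> for both cells (\<open>two_cells\<close>).  It is proved by comparison with a Platonic
  solid.

  A plane graph with \<open>N\<close> darts is encoded by two permutations of its darts, reversal and rotation
  around the initial vertex.  Their cycles are edges and vertices, and the cycles of the composition
  are the boundary walks.  Euler's formula becomes
  \<open>N (1 / k + 1 / l - 1 / 2) = u\<^sub>1 / k\<^sub>1 + u\<^sub>2 / k\<^sub>2 > 0\<close>, so that there is a regular map \<open>X\<close> of type
  \<open>(k, l)\<close> on the sphere, with \<open>M\<close> darts and \<open>M (1 / k + 1 / l - 1 / 2) = 2\<close>
  (\<open>regular_sphere_map_exists\<close>).

  Let the permutations act on pairs of a dart of the graph and a dart of \<open>X\<close>.  A connected
  component of this action is a map that covers the graph with some degree \<open>h\<close> and \<open>X\<close> with some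
  degree \<open>n\<close>, so \<open>h N = n M\<close>.  Over a cell of degree \<open>u\<close>, whose counterparts in \<open>X\<close> have degree \<open>k\<close>, it has
  cells of degree \<open>lcm u k\<close>, and counting darts gives \<open>lcm u k \<le> h u\<close> and \<open>lcm u k \<le> n k\<close>
  (\<open>common_cover_with_regular\<close>).  Its Euler characteristic is
  \<open>h (u\<^sub>1 / lcm u\<^sub>1 k\<^sub>1 + u\<^sub>2 / lcm u\<^sub>2 k\<^sub>2)\<close>, which is at most 2, although both summands
  are at least 1.  So both are equal to 1, and therefore \<open>u\<^sub>i / k\<^sub>i \<le> n / h\<close>.  But the sum of
  the two quotients is \<open>N (1 / k + 1 / l - 1 / 2) = 2 n / h\<close>, hence both are equal to \<open>n / h\<close>.

  If there is only one exceptional cell, any cell of the other kind, whose degree is regular,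
  serves as the second distinguished cell; then the quotient is 1 for both cells, a contradiction.  For two exceptional faces the claim is immediate.  For a vertex and a face, \<open>h\<close> is a
  common divisor of \<open>k\<close> and \<open>l\<close>.  If \<open>h = 1\<close>, then the degrees are divisible by \<open>k\<close> and \<open>l\<close>.  Otherwise the
  list of spherical types leaves \<open>k = l = 3\<close>, \<open>k = 2\<close> or \<open>l = 2\<close>, and in the last two cases the
  handshake lemma makes the exceptional degree even, which forces \<open>h = 1\<close>.

  The two halves of Euler's formula \<open>V - E + F = 2\<close> have different sources.  That the left-hand side
  is at most 2 holds for every connected pair of permutations (\<open>euler_genus_bound\<close>); this half is also
  the one that is applied to the common covering.  That it is at least 2 uses the embedding: if the
  edges are drawn one by one, every edge that closes a cycle increases the number of complementary
  components, by the Jordan curve theorem (\<open>faces_lower_bound\<close>).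
\<close>

section \<open>Connected components of a finite relation\<close>

definition generated_equiv :: "'a set \<Rightarrow> ('a \<times> 'a) set \<Rightarrow> ('a \<times> 'a) set" where
  "generated_equiv Y E = {(x, y). x \<in> Y \<and> y \<in> Y \<and> (x, y) \<in> (E \<union> E\<inverse>)\<^sup>*}"

definition ncomp :: "'a set \<Rightarrow> ('a \<times> 'a) set \<Rightarrow> nat" where
  "ncomp Y E = card (Y // generated_equiv Y E)"

lemma equiv_generated_equiv: "equiv Y (generated_equiv Y E)"
proof (rule equivI)
  have "sym ((E \<union> E\<inverse>)\<^sup>*)"
    by (intro sym_rtrancl) (auto simp: sym_def)
  then show "sym (generated_equiv Y E)"
    unfolding generated_equiv_def sym_def by blast
qed (auto simp: generated_equiv_def refl_on_def trans_def intro: rtrancl_trans)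

lemma generated_equiv_incl:
  assumes "E \<subseteq> Y \<times> Y"
  shows "E \<subseteq> generated_equiv Y E"
  using assms by (auto simp: generated_equiv_def)

lemma generated_equiv_least:
  assumes Q: "equiv Y Q" and E: "E \<subseteq> Q"
  shows "generated_equiv Y E \<subseteq> Q"
proof
  fix z assume "z \<in> generated_equiv Y E"
  then obtain x y where z: "z = (x, y)" "x \<in> Y" "(x, y) \<in> (E \<union> E\<inverse>)\<^sup>*"
    by (auto simp: generated_equiv_def)
  from z(3) have "(x, y) \<in> Q"
  proof (induction rule: rtrancl_induct)
    case base
    then show ?case using Q z(2) by (auto simp: equiv_def refl_on_def)
  next
    case (step y w)
    then have "(y, w) \<in> Q"
      using E Q by (auto simp: equiv_def sym_def)
    then show ?case
      using step Q by (auto simp: equiv_def dest: transD)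
  qed
  then show "z \<in> Q" using z by simp
qed

lemma generated_equiv_mono:
  assumes "E \<subseteq> generated_equiv Y E'"
  shows "generated_equiv Y E \<subseteq> generated_equiv Y E'"
  using generated_equiv_least[OF equiv_generated_equiv assms] .

lemma card_quotient_antimono:
  assumes Y: "finite Y" and R: "equiv Y R" "equiv Y R'" and sub: "R \<subseteq> R'"
  shows "card (Y // R') \<le> card (Y // R)"
proof -
  have "Y // R' \<subseteq> (\<lambda>C. R' `` C) ` (Y // R)"
  proof
    fix C assume "C \<in> Y // R'"
    then obtain x where x: "x \<in> Y" "C = R' `` {x}" by (auto elim: quotientE)
    have "R' `` (R `` {x}) = R' `` {x}"
      using R sub x by (auto simp: equiv_def refl_on_def sym_def dest: transD)
    then show "C \<in> (\<lambda>C. R' `` C) ` (Y // R)"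
      using x by (auto intro!: image_eqI[where x = "R `` {x}"] quotientI)
  qed
  moreover have "finite (Y // R)"
    using Y R by (simp add: finite_quotient equiv_type)
  ultimately show ?thesis by (rule surj_card_le[rotated])
qed

lemma ncomp_antimono:
  assumes "finite Y" "E \<subseteq> generated_equiv Y E'"
  shows "ncomp Y E' \<le> ncomp Y E"
  unfolding ncomp_def
  using assms by (intro card_quotient_antimono equiv_generated_equiv generated_equiv_mono)

lemma ncomp_le_card: "finite Y \<Longrightarrow> ncomp Y E \<le> card Y"
  unfolding ncomp_def quotient_def UNION_singleton_eq_range by (rule card_image_le)

lemma ncomp_pos:
  assumes "finite Y" "Y \<noteq> {}"
  shows "0 < ncomp Y E"
proof -
  have "finite (Y // generated_equiv Y E)"
    using assms finite_quotient[OF _ ] equiv_type[OF equiv_generated_equiv] by blast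
  then show ?thesis
    using assms by (simp add: ncomp_def card_gt_0_iff)
qed

text \<open>One more edge unites the classes of its two ends and keeps all other classes.  The number of
  classes therefore drops by one or stays the same, which is what all counting below relies on.\<close>

lemma quotient_generated_equiv_insert:
  assumes E: "E \<subseteq> Y \<times> Y" and xy: "x \<in> Y" "y \<in> Y"
  defines "R \<equiv> generated_equiv Y E"
  shows "Y // generated_equiv Y (insert (x, y) E) =
    insert (R `` {x} \<union> R `` {y}) (Y // R - {R `` {x}, R `` {y}})"
proof -
  let ?R' = "generated_equiv Y (insert (x, y) E)"
  let ?A = "R `` {x} \<union> R `` {y}"
  have eR: "equiv Y R" unfolding R_def by (rule equiv_generated_equiv)
  have eR': "equiv Y ?R'" by (rule equiv_generated_equiv)
  have sub: "R \<subseteq> ?R'"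
    unfolding R_def using assms by (intro generated_equiv_mono) (auto simp: generated_equiv_def)
  have xyR': "(x, y) \<in> ?R'"
    using xy by (auto simp: generated_equiv_def)
  have R: "(a, a) \<in> R" if "a \<in> Y" for a using eR that by (auto simp: equiv_def refl_on_def)
  have symR: "(b, a) \<in> R" if "(a, b) \<in> R" for a b using eR that by (auto simp: equiv_def sym_def)
  have transR: "(a, c) \<in> R" if "(a, b) \<in> R" "(b, c) \<in> R" for a b c
    using eR that by (auto simp: equiv_def dest: transD)
  have RY: "a \<in> Y" "b \<in> Y" if "(a, b) \<in> R" for a b
    using that by (auto simp: R_def generated_equiv_def)
  have symR': "(b, a) \<in> ?R'" if "(a, b) \<in> ?R'" for a b
    using eR' that by (auto simp: equiv_def sym_def)
  have transR': "(a, c) \<in> ?R'" if "(a, b) \<in> ?R'" "(b, c) \<in> ?R'" for a b c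
    using eR' that by (auto simp: equiv_def dest: transD)
  let ?Q = "R \<union> ?A \<times> ?A"
  have eQ: "equiv Y ?Q"
  proof (rule equivI)
    show "?Q \<subseteq> Y \<times> Y" using RY by auto
    show "refl_on Y ?Q" using R by (auto simp: refl_on_def)
    show "sym ?Q" using symR by (auto simp: sym_def)
    have *: "b \<in> ?A" if "a \<in> ?A" "(a, b) \<in> R" for a b
      using that transR by blast
    show "trans ?Q"
    proof (rule transI)
      fix a b c assume "(a, b) \<in> ?Q" "(b, c) \<in> ?Q"
      then show "(a, c) \<in> ?Q"
        using *[of a b] *[of b c] *[of b a] symR[of a b] transR[of a b c] by auto
    qed
  qed
  have "?R' \<subseteq> ?Q"
    by (rule generated_equiv_least[OF eQ])
       (use generated_equiv_incl[OF E] R xy in \<open>auto simp: R_def\<close>)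
  moreover have "?Q \<subseteq> ?R'"
  proof -
    have "(x, a) \<in> ?R'" if "a \<in> ?A" for a
      using that sub xyR' transR' by blast
    then have "(a, b) \<in> ?R'" if "a \<in> ?A" "b \<in> ?A" for a b
      using that transR' symR' by metis
    then show ?thesis using sub by blast
  qed
  ultimately have R': "?R' = ?Q" by blast
  have cls_in: "?Q `` {z} = ?A" if "z \<in> ?A" for z
  proof -
    have "R `` {z} \<subseteq> ?A" using that transR by blast
    moreover have "?Q `` {z} = R `` {z} \<union> ?A" using that by blast
    ultimately show ?thesis by blast
  qed
  have cls_out: "?Q `` {z} = R `` {z}" if "z \<notin> ?A" for z
    using that by blast
  have cl_eq: "R `` {a} = R `` {b} \<longleftrightarrow> (a, b) \<in> R" if "a \<in> Y" "b \<in> Y" for a b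
    using eq_equiv_class_iff[OF eR that] .
  show ?thesis (is "?lhs = ?rhs")
  proof
    show "?lhs \<subseteq> ?rhs"
    proof
      fix C assume "C \<in> ?lhs"
      then obtain z where z: "z \<in> Y" "C = ?Q `` {z}" unfolding R' by (auto elim: quotientE)
      show "C \<in> ?rhs"
      proof (cases "z \<in> ?A")
        case False
        then have C: "C = R `` {z}"
          using z(2) cls_out[OF False] by simp
        have "(z, x) \<notin> R" "(z, y) \<notin> R" using False symR by blast+
        then have "R `` {z} \<noteq> R `` {x}" "R `` {z} \<noteq> R `` {y}"
          using cl_eq[OF z(1) xy(1)] cl_eq[OF z(1) xy(2)] by simp_all
        moreover have "R `` {z} \<in> Y // R" using z(1) by (rule quotientI)
        ultimately show ?thesis unfolding C by blast
      next
        case True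
        then have "C = ?A"
          using z(2) cls_in[OF True] by simp
        then show ?thesis by blast
      qed
    qed
    show "?rhs \<subseteq> ?lhs"
    proof
      fix C assume "C \<in> ?rhs"
      then consider "C = ?A" | "C \<in> Y // R" "C \<noteq> R `` {x}" "C \<noteq> R `` {y}" by blast
      then show "C \<in> ?lhs"
      proof cases
        case 1
        have "x \<in> ?A" using R xy by blast
        then have "C = ?Q `` {x}" using cls_in[of x] 1 by simp
        then show ?thesis unfolding R' using quotientI[OF xy(1), of ?Q] by simp
      next
        case 2
        then obtain z where z: "z \<in> Y" "C = R `` {z}" by (auto elim: quotientE)
        have "(z, x) \<notin> R" "(z, y) \<notin> R"
          using 2(2,3) cl_eq[OF z(1) xy(1)] cl_eq[OF z(1) xy(2)] unfolding z(2) by simp_all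
        then have "z \<notin> ?A" using symR by blast
        then have "C = ?Q `` {z}" using cls_out[of z] z(2) by simp
        then show ?thesis unfolding R' using quotientI[OF z(1), of ?Q] by simp
      qed
    qed
  qed
qed

lemma ncomp_insert_ge:
  assumes Y: "finite Y" and E: "E \<subseteq> Y \<times> Y" and xy: "x \<in> Y" "y \<in> Y"
  shows "ncomp Y E \<le> ncomp Y (insert (x, y) E) + 1"
proof -
  let ?R = "generated_equiv Y E"
  let ?Q = "Y // ?R"
  let ?A = "?R `` {x} \<union> ?R `` {y}"
  have fin: "finite ?Q"
    using Y finite_quotient equiv_type[OF equiv_generated_equiv] by blast
  have eR: "equiv Y ?R" by (rule equiv_generated_equiv)
  show ?thesis
  proof (cases "(x, y) \<in> ?R")
    case True
    then have eq: "?R `` {x} = ?R `` {y}" using equiv_class_eq[OF eR] by simp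
    have "?R `` {y} \<in> ?Q" using xy by (intro quotientI)
    then have "insert ?A (?Q - {?R `` {x}, ?R `` {y}}) = ?Q" using eq by auto
    then show ?thesis
      using quotient_generated_equiv_insert[OF E xy] by (simp add: ncomp_def)
  next
    case False
    have "?A \<notin> ?Q"
    proof
      assume "?A \<in> ?Q"
      moreover have "x \<in> ?A" "y \<in> ?A" using xy eR by (auto simp: equiv_def refl_on_def)
      ultimately have "(x, y) \<in> ?R" using in_quotient_imp_in_rel[OF eR, of ?A x y] by simp
      then show False using False by simp
    qed
    have "card ?Q \<le> card (?Q - {?R `` {x}, ?R `` {y}}) + card {?R `` {x}, ?R `` {y}}"
      using diff_card_le_card_Diff[of "{?R `` {x}, ?R `` {y}}" ?Q] by simp
    also have "card {?R `` {x}, ?R `` {y}} \<le> 2" by (simp add: card_insert_if)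
    finally have "card ?Q \<le> card (?Q - {?R `` {x}, ?R `` {y}}) + 2" by simp
    moreover have "card (insert ?A (?Q - {?R `` {x}, ?R `` {y}})) =
        card (?Q - {?R `` {x}, ?R `` {y}}) + 1"
      using \<open>?A \<notin> ?Q\<close> fin by simp
    ultimately show ?thesis
      using quotient_generated_equiv_insert[OF E xy] by (simp add: ncomp_def)
  qed
qed

lemma ncomp_insert_unrelated:
  assumes Y: "finite Y" and E: "E \<subseteq> Y \<times> Y" and xy: "x \<in> Y" "y \<in> Y"
    and un: "(x, y) \<notin> generated_equiv Y E"
  shows "ncomp Y (insert (x, y) E) + 1 \<le> ncomp Y E"
proof -
  let ?R = "generated_equiv Y E"
  let ?Q = "Y // ?R"
  let ?B = "{?R `` {x}, ?R `` {y}}"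
  have fin: "finite ?Q"
    using Y finite_quotient equiv_type[OF equiv_generated_equiv] by blast
  have "?R `` {x} \<noteq> ?R `` {y}"
    using un eq_equiv_class_iff[OF equiv_generated_equiv xy] by blast
  then have "card ?B = 2" by simp
  moreover have B: "?B \<subseteq> ?Q" using xy by (auto intro: quotientI)
  ultimately have "card (?Q - ?B) + 2 = card ?Q"
    using fin card_mono[OF fin B] by (simp add: card_Diff_subset)
  moreover have "card (insert (?R `` {x} \<union> ?R `` {y}) (?Q - ?B)) \<le> card (?Q - ?B) + 1"
    using fin by (simp add: card_insert_if)
  ultimately show ?thesis
    using quotient_generated_equiv_insert[OF E xy] by (simp add: ncomp_def)
qed

text \<open>Every class \<open>C\<close> contributes \<open>card C\<close> summands \<open>1 / card C\<close>.  In this form Euler characteristics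
  are sums over darts, and such sums behave well under coverings.\<close>

lemma card_quotient_eq_sum:
  assumes Y: "finite Y" and R: "equiv Y R"
  shows "real (card (Y // R)) = (\<Sum>y\<in>Y. 1 / real (card (R `` {y})))"
proof -
  have finC: "finite C" "C \<noteq> {}" if "C \<in> Y // R" for C
    using finite_subset[OF in_quotient_imp_subset[OF R that] Y] in_quotient_imp_non_empty[OF R that]
    by auto
  have "(\<Sum>y\<in>Y. 1 / real (card (R `` {y}))) = (\<Sum>y\<in>\<Union>(Y // R). 1 / real (card (R `` {y})))"
    using Union_quotient[OF R] by simp
  also have "\<dots> = (\<Sum>C\<in>Y // R. \<Sum>y\<in>C. 1 / real (card (R `` {y})))"
    by (rule sum.Union_disjoint[unfolded comp_def]) (use finC(1) quotient_disj[OF R] in blast)+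
  also have "\<dots> = (\<Sum>C\<in>Y // R. \<Sum>y\<in>C. 1 / real (card C))"
  proof (intro sum.cong refl)
    fix C y assume "C \<in> Y // R" "y \<in> C"
    then have "R `` {y} = C"
      using R by (metis Image_singleton_iff equiv_class_eq quotientE)
    then show "1 / real (card (R `` {y})) = 1 / real (card C)" by simp
  qed
  also have "\<dots> = (\<Sum>C\<in>Y // R. 1)"
    by (intro sum.cong refl) (use finC in \<open>simp add: card_gt_0_iff\<close>)
  finally show ?thesis by simp
qed

section \<open>Cycles of permutations\<close>

abbreviation fun_edges :: "'a set \<Rightarrow> ('a \<Rightarrow> 'a) \<Rightarrow> ('a \<times> 'a) set" where
  "fun_edges Y f \<equiv> (\<lambda>y. (y, f y)) ` Y"

abbreviation cycle_of_elem :: "'a set \<Rightarrow> ('a \<Rightarrow> 'a) \<Rightarrow> 'a \<Rightarrow> 'a set" where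
  "cycle_of_elem Y f y \<equiv> generated_equiv Y (fun_edges Y f) `` {y}"

definition cycle_length :: "'a set \<Rightarrow> ('a \<Rightarrow> 'a) \<Rightarrow> 'a \<Rightarrow> nat" where
  "cycle_length Y f y = card (cycle_of_elem Y f y)"

definition ncycles :: "'a set \<Rightarrow> ('a \<Rightarrow> 'a) \<Rightarrow> nat" where
  "ncycles Y f = ncomp Y (fun_edges Y f)"

definition perm_on :: "('a \<Rightarrow> 'a) \<Rightarrow> 'a set \<Rightarrow> bool" where
  "perm_on f Y \<longleftrightarrow> finite Y \<and> inj_on f Y \<and> f ` Y \<subseteq> Y"

lemma perm_on_funpow:
  assumes "perm_on f Y" "y \<in> Y"
  shows "(f ^^ n) y \<in> Y"
  using assms by (induction n) (auto simp: perm_on_def)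

lemma fun_edges_subset: "perm_on f Y \<Longrightarrow> fun_edges Y f \<subseteq> Y \<times> Y"
  by (auto simp: perm_on_def)

lemma perm_on_funpow_inj:
  assumes f: "perm_on f Y" and "x \<in> Y" "y \<in> Y" "(f ^^ n) x = (f ^^ n) y"
  shows "x = y"
  using assms(2-)
proof (induction n)
  case (Suc n)
  then have "(f ^^ n) x = (f ^^ n) y"
    using perm_on_funpow[OF f] f by (auto simp: perm_on_def inj_on_def)
  then show ?case using Suc by simp
qed simp

lemma perm_on_funpow_shift:
  assumes f: "perm_on f Y" and y: "y \<in> Y" and eq: "(f ^^ i) y = (f ^^ j) y" and "i \<le> j"
  shows "(f ^^ (j - i)) y = y"
proof -
  have "(f ^^ i) ((f ^^ (j - i)) y) = (f ^^ i) y"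
    using eq \<open>i \<le> j\<close> by (metis funpow_add le_add_diff_inverse o_apply)
  then show ?thesis
    using perm_on_funpow_inj[OF f] perm_on_funpow[OF f y] y by metis
qed

lemma perm_on_period_exists:
  assumes f: "perm_on f Y" and y: "y \<in> Y"
  shows "\<exists>n>0. (f ^^ n) y = y"
proof -
  have "\<not> inj (\<lambda>n. (f ^^ n) y)"
  proof
    assume "inj (\<lambda>n. (f ^^ n) y)"
    then have "infinite (range (\<lambda>n. (f ^^ n) y))" using range_inj_infinite by blast
    moreover have "range (\<lambda>n. (f ^^ n) y) \<subseteq> Y" using perm_on_funpow[OF f y] by blast
    ultimately show False using f finite_subset by (auto simp: perm_on_def)
  qed
  then obtain i j where "i \<noteq> j" "(f ^^ i) y = (f ^^ j) y" by (auto simp: inj_def)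
  then obtain i j where "i < j" "(f ^^ i) y = (f ^^ j) y" by (metis nat_neq_iff)
  then have "(f ^^ (j - i)) y = y" "j - i > 0"
    using perm_on_funpow_shift[OF f y, of i j] by simp_all
  then show ?thesis by blast
qed

text \<open>Powers with non-negative exponents suffice: on a finite set the inverse of a permutation is
  locally one of its powers.\<close>

lemma cycle_of_elem_eq_orbit:
  assumes f: "perm_on f Y" and y: "y \<in> Y"
  shows "cycle_of_elem Y f y = range (\<lambda>n. (f ^^ n) y)"
proof
  have "(y, (f ^^ n) y) \<in> (fun_edges Y f \<union> (fun_edges Y f)\<inverse>)\<^sup>*" for n
  proof (induction n)
    case (Suc n)
    have "((f ^^ n) y, (f ^^ Suc n) y) \<in> fun_edges Y f"
      using perm_on_funpow[OF f y] by simp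
    then show ?case using Suc by (meson UnI1 rtrancl.rtrancl_into_rtrancl)
  qed simp
  then show "range (\<lambda>n. (f ^^ n) y) \<subseteq> cycle_of_elem Y f y"
    using y perm_on_funpow[OF f y] by (auto simp: generated_equiv_def)
  show "cycle_of_elem Y f y \<subseteq> range (\<lambda>n. (f ^^ n) y)"
  proof
    fix z assume "z \<in> cycle_of_elem Y f y"
    then have "(y, z) \<in> (fun_edges Y f \<union> (fun_edges Y f)\<inverse>)\<^sup>*"
      by (simp add: generated_equiv_def)
    then have "\<exists>n. z = (f ^^ n) y"
    proof (induction rule: rtrancl_induct)
      case base
      show ?case by (rule exI[of _ 0]) simp
    next
      case (step z w)
      then obtain n where n: "z = (f ^^ n) y" by blast
      show ?case
      proof (cases "(z, w) \<in> fun_edges Y f")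
        case True
        then have "w = (f ^^ Suc n) y" using n by auto
        then show ?thesis by blast
      next
        case False
        then have w: "w \<in> Y" "z = f w" using step by auto
        obtain m where m: "m > 0" "(f ^^ m) y = y" using perm_on_period_exists[OF f y] by blast
        obtain n' where n': "n + m = Suc n'" using m by (cases "n + m") auto
        have "f w = f ((f ^^ n') y)"
          using n w m n' by (metis funpow.simps(2) funpow_add o_apply)
        then have "w = (f ^^ n') y"
          using f w perm_on_funpow[OF f y] by (auto simp: perm_on_def inj_on_def)
        then show ?thesis by blast
      qed
    qed
    then show "z \<in> range (\<lambda>n. (f ^^ n) y)" by blast
  qed
qed

lemma cycle_of_elem_subset: "cycle_of_elem Y f y \<subseteq> Y"
  by (auto simp: generated_equiv_def)

lemma funpow_fixed_iff_dvd:
  assumes f: "perm_on f Y" and y: "y \<in> Y"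
  shows "(f ^^ n) y = y \<longleftrightarrow> cycle_length Y f y dvd n"
proof -
  define m where "m = (LEAST n. n > 0 \<and> (f ^^ n) y = y)"
  have m: "m > 0" "(f ^^ m) y = y"
    using LeastI_ex[OF perm_on_period_exists[OF f y]] unfolding m_def by auto
  have min: "(f ^^ i) y \<noteq> y" if "0 < i" "i < m" for i
    using that not_less_Least[of i "\<lambda>n. n > 0 \<and> (f ^^ n) y = y"] unfolding m_def by auto
  have mod: "(f ^^ (i mod m)) y = (f ^^ i) y" for i
    by (rule funpow_mod_eq[OF m(2)])
  have "inj_on (\<lambda>n. (f ^^ n) y) {..<m}"
  proof (rule linorder_inj_onI)
    fix i j assume ij: "i < j" "i \<in> {..<m}" "j \<in> {..<m}"
    then have "0 < j - i" "j - i < m" by auto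
    then show "(f ^^ i) y \<noteq> (f ^^ j) y"
      using min perm_on_funpow_shift[OF f y, of i j] ij(1) by auto
  qed auto
  moreover have "range (\<lambda>n. (f ^^ n) y) = (\<lambda>n. (f ^^ n) y) ` {..<m}"
  proof
    show "range (\<lambda>n. (f ^^ n) y) \<subseteq> (\<lambda>n. (f ^^ n) y) ` {..<m}"
    proof
      fix z assume "z \<in> range (\<lambda>n. (f ^^ n) y)"
      then obtain i where "z = (f ^^ i) y" by blast
      then have "z = (f ^^ (i mod m)) y" "i mod m \<in> {..<m}" using mod m(1) by auto
      then show "z \<in> (\<lambda>n. (f ^^ n) y) ` {..<m}" by blast
    qed
  qed auto
  ultimately have len: "cycle_length Y f y = m"
    by (simp add: cycle_length_def cycle_of_elem_eq_orbit[OF f y] card_image)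
  have "(f ^^ n) y = y \<longleftrightarrow> n mod m = 0"
    using mod[of n] min[of "n mod m"] m(1) by (cases "n mod m = 0") auto
  then show ?thesis using len by (simp add: dvd_eq_mod_eq_0)
qed

text \<open>The powers of a product act on each coordinate separately, so that the exponents that fix a point
  are easy to find there; they determine the cycle length.\<close>

lemma cycle_length_eqI:
  assumes f: "perm_on f Y" and y: "y \<in> Y" and dvd: "\<And>n. (f ^^ n) y = y \<longleftrightarrow> k dvd n"
  shows "cycle_length Y f y = k"
proof (rule dvd_antisym)
  show "cycle_length Y f y dvd k"
    using dvd[of k] funpow_fixed_iff_dvd[OF f y, of k] by simp
  show "k dvd cycle_length Y f y"
    using dvd[of "cycle_length Y f y"] funpow_fixed_iff_dvd[OF f y, of "cycle_length Y f y"] by simp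
qed

lemma ncycles_eq_sum:
  assumes "finite Y"
  shows "real (ncycles Y f) = (\<Sum>y\<in>Y. 1 / real (cycle_length Y f y))"
  unfolding ncycles_def ncomp_def cycle_length_def
  using card_quotient_eq_sum[OF assms equiv_generated_equiv] .

lemma perm_on_subset:
  assumes "perm_on f Y" "Z \<subseteq> Y" "f ` Z \<subseteq> Z"
  shows "perm_on f Z"
  using assms(3) finite_subset[OF assms(2)] inj_on_subset[OF _ assms(2), of f] assms(1)
  unfolding perm_on_def by simp

lemma perm_on_image_eq: "perm_on f Y \<Longrightarrow> f ` Y = Y"
  unfolding perm_on_def by (intro endo_inj_surj) simp_all

lemma perm_on_map_prod:
  assumes "perm_on f Y" "perm_on g Z"
  shows "perm_on (map_prod f g) (Y \<times> Z)"
  using assms map_prod_inj_on[of f Y g Z] unfolding perm_on_def by auto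

lemma funpow_map_prod:
  fixes f :: "'a \<Rightarrow> 'a" and g :: "'b \<Rightarrow> 'b"
  shows "(map_prod f g ^^ n) (x, y) = ((f ^^ n) x, (g ^^ n) y)"
  by (induction n) auto

lemma cycle_length_map_prod:
  assumes f: "perm_on f Y" and g: "perm_on g Z" and U: "perm_on (map_prod f g) U"
    and xy: "(x, y) \<in> U" "x \<in> Y" "y \<in> Z"
  shows "cycle_length U (map_prod f g) (x, y) = lcm (cycle_length Y f x) (cycle_length Z g y)"
  by (rule cycle_length_eqI[OF U xy(1)])
     (simp add: funpow_map_prod funpow_fixed_iff_dvd[OF f xy(2)] funpow_fixed_iff_dvd[OF g xy(3)])

lemma cycle_length_cong:
  assumes "\<And>y. y \<in> Y \<Longrightarrow> f y = g y"
  shows "cycle_length Y f x = cycle_length Y g x"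
proof -
  have "fun_edges Y f = fun_edges Y g" using assms by (intro image_cong) auto
  then show ?thesis by (simp add: cycle_length_def)
qed

section \<open>The genus of a combinatorial map is not negative\<close>

text \<open>Exchanging the values of a permutation at \<open>x\<close> and \<open>y\<close>, that is, composing it with a
  transposition, does not change the equivalence that it generates together with \<open>x \<sim> y\<close>.\<close>

lemma fun_edges_fun_upd_subset:
  assumes f: "perm_on f Y" and xy: "x \<in> Y" "y \<in> Y" "x \<noteq> y"
    and R: "equiv Y R" "(x, y) \<in> R" and sub: "fun_edges Y (f(x := f y, y := f x)) \<subseteq> R"
  shows "fun_edges Y f \<subseteq> R"
proof
  let ?g = "f(x := f y, y := f x)"
  have g: "(z, ?g z) \<in> R" if "z \<in> Y" for z using sub that by blast
  have symR: "(b, a) \<in> R" if "(a, b) \<in> R" for a b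
    using R that by (auto simp: equiv_def sym_def)
  have transR: "(a, c) \<in> R" if "(a, b) \<in> R" "(b, c) \<in> R" for a b c
    using R that by (auto simp: equiv_def dest: transD)
  fix e assume "e \<in> fun_edges Y f"
  then obtain z where z: "z \<in> Y" "e = (z, f z)" by blast
  consider "z = x" | "z = y" | "z \<noteq> x" "z \<noteq> y" by blast
  then show "e \<in> R"
  proof cases
    case 1
    have "(y, f x) \<in> R" using g[OF xy(2)] by simp
    then show ?thesis using transR[OF R(2)] z 1 by simp
  next
    case 2
    have "(x, f y) \<in> R" using g[OF xy(1)] xy(3) by simp
    then show ?thesis using transR[OF symR[OF R(2)]] z 2 by simp
  next
    case 3
    then show ?thesis using g[OF z(1)] z by simp
  qed
qed

lemma ncycles_fun_upd_le:
  assumes f: "perm_on f Y" and xy: "x \<in> Y" "y \<in> Y" "x \<noteq> y"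
  shows "ncycles Y (f(x := f y, y := f x)) \<le> ncycles Y f + 1"
proof -
  let ?E = "fun_edges Y (f(x := f y, y := f x))"
  have Y: "finite Y" using f by (simp add: perm_on_def)
  have E: "?E \<subseteq> Y \<times> Y" using f xy by (auto simp: perm_on_def)
  have "fun_edges Y f \<subseteq> generated_equiv Y (insert (x, y) ?E)"
  proof (rule fun_edges_fun_upd_subset[OF f xy equiv_generated_equiv])
    have "insert (x, y) ?E \<subseteq> generated_equiv Y (insert (x, y) ?E)"
      by (rule generated_equiv_incl) (use E xy in blast)
    then show "(x, y) \<in> generated_equiv Y (insert (x, y) ?E)"
      "?E \<subseteq> generated_equiv Y (insert (x, y) ?E)" by blast+
  qed
  then have "ncomp Y (insert (x, y) ?E) \<le> ncomp Y (fun_edges Y f)"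
    by (rule ncomp_antimono[OF Y])
  moreover have "ncomp Y ?E \<le> ncomp Y (insert (x, y) ?E) + 1"
    using ncomp_insert_ge[OF Y E xy(1,2)] .
  ultimately show ?thesis by (simp add: ncycles_def)
qed

text \<open>A transposition of points of different cycles joins these cycles: after the exchange, the point
  \<open>y\<close> is sent to \<open>f x\<close> and from there along the old cycle of \<open>x\<close> back to \<open>x\<close>.\<close>

lemma ncycles_fun_upd_merge:
  assumes f: "perm_on f Y" and xy: "x \<in> Y" "y \<in> Y" "x \<noteq> y"
    and un: "(x, y) \<notin> generated_equiv Y (fun_edges Y f)"
  shows "ncycles Y (f(x := f y, y := f x)) + 1 \<le> ncycles Y f"
proof -
  let ?g = "f(x := f y, y := f x)"
  let ?E = "fun_edges Y ?g"
  let ?R = "generated_equiv Y ?E"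
  have Y: "finite Y" using f by (simp add: perm_on_def)
  have E: "?E \<subseteq> Y \<times> Y" using f xy by (auto simp: perm_on_def)
  have eR: "equiv Y ?R" by (rule equiv_generated_equiv)
  have incl: "?E \<subseteq> ?R" by (rule generated_equiv_incl[OF E])
  have symR: "(b, a) \<in> ?R" if "(a, b) \<in> ?R" for a b
    using eR that by (auto simp: equiv_def sym_def)
  have transR: "(a, c) \<in> ?R" if "(a, b) \<in> ?R" "(b, c) \<in> ?R" for a b c
    using eR that by (auto simp: equiv_def dest: transD)
  have ny: "(f ^^ i) x \<noteq> y" for i
    using un cycle_of_elem_eq_orbit[OF f xy(1)] by blast
  define n where "n = (LEAST n. n > 0 \<and> (f ^^ n) x = x)"
  have n: "n > 0" "(f ^^ n) x = x"
    using LeastI_ex[OF perm_on_period_exists[OF f xy(1)]] unfolding n_def by auto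
  have min: "(f ^^ i) x \<noteq> x" if "0 < i" "i < n" for i
    using that not_less_Least[of i "\<lambda>n. n > 0 \<and> (f ^^ n) x = x"] unfolding n_def by auto
  have "(y, (f ^^ Suc i) x) \<in> ?R" if "Suc i \<le> n" for i
    using that
  proof (induction i)
    case 0
    have "(y, ?g y) \<in> ?E" using xy(2) by (rule imageI)
    then have "(y, ?g y) \<in> ?R" using incl by (rule subsetD[rotated])
    moreover have "?g y = (f ^^ Suc 0) x" by simp
    ultimately show ?case by (simp only:)
  next
    case (Suc i)
    let ?z = "(f ^^ Suc i) x"
    have "?z \<noteq> x" "?z \<noteq> y" using min[of "Suc i"] ny[of "Suc i"] Suc.prems by auto
    then have "?g ?z = (f ^^ Suc (Suc i)) x" by simp
    moreover have "(?z, ?g ?z) \<in> ?E" using perm_on_funpow[OF f xy(1)] by (rule imageI)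
    ultimately have "(?z, (f ^^ Suc (Suc i)) x) \<in> ?E" by (simp only:)
    then have "(?z, (f ^^ Suc (Suc i)) x) \<in> ?R" using incl by (rule subsetD[rotated])
    moreover have "(y, ?z) \<in> ?R" using Suc.IH Suc.prems by (meson Suc_leD)
    ultimately show ?case using transR by blast
  qed
  from this[of "n - 1"] have yx: "(x, y) \<in> ?R" using n symR by simp
  have "insert (x, y) (fun_edges Y f) \<subseteq> ?R"
    using yx fun_edges_fun_upd_subset[OF f xy eR yx incl] by blast
  then have "ncomp Y ?E \<le> ncomp Y (insert (x, y) (fun_edges Y f))"
    by (rule ncomp_antimono[OF Y])
  moreover have "ncomp Y (insert (x, y) (fun_edges Y f)) + 1 \<le> ncomp Y (fun_edges Y f)"
    using ncomp_insert_unrelated[OF Y fun_edges_subset[OF f] xy(1,2) un] .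
  ultimately show ?thesis by (simp add: ncycles_def)
qed

lemma perm_on_fun_upd:
  assumes "perm_on f Y" "x \<in> Y" "y \<in> Y" "x \<noteq> y"
  shows "perm_on (f(x := f y, y := f x)) Y"
proof -
  have "f \<circ> Transposition.transpose x y = f(x := f y, y := f x)"
    by (auto simp: Transposition.transpose_def fun_eq_iff)
  moreover have "inj_on (f \<circ> Transposition.transpose x y) Y"
    by (rule comp_inj_on) (use assms in \<open>auto simp: perm_on_def\<close>)
  ultimately show ?thesis using assms by (auto simp: perm_on_def)
qed

text \<open>The elements of \<open>D\<close> are darts; \<open>a\<close> reverses a dart and \<open>s\<close> rotates it around its initial vertex.
  Vertices are cycles of \<open>s\<close>, edges are cycles of \<open>a\<close>, and faces are cycles of \<open>s \<circ> a\<close>.\<close>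

locale combinatorial_map =
  fixes D :: "'a set" and s a :: "'a \<Rightarrow> 'a"
  assumes perm_s: "perm_on s D"
    and a_closed: "d \<in> D \<Longrightarrow> a d \<in> D"
    and a_a: "d \<in> D \<Longrightarrow> a (a d) = d"
    and a_ne: "d \<in> D \<Longrightarrow> a d \<noteq> d"
begin

lemma finite_darts: "finite D"
  using perm_s by (simp add: perm_on_def)

lemma perm_a: "perm_on a D"
  using finite_darts a_closed a_a by (auto simp: perm_on_def intro!: inj_on_inverseI[where g = a])

lemma perm_face: "perm_on (s \<circ> a) D"
  using perm_s perm_a by (auto simp: perm_on_def intro!: comp_inj_on inj_on_subset[of s D])

definition connected_map :: bool where
  "connected_map \<longleftrightarrow> (\<forall>Z \<subseteq> D. Z \<noteq> {} \<longrightarrow> s ` Z \<subseteq> Z \<longrightarrow> a ` Z \<subseteq> Z \<longrightarrow> Z = D)"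

text \<open>The choice between \<open>d\<close> and \<open>a d\<close> depends only on the set \<open>{d, a d}\<close>, so that it is the same for
  both darts of an edge.\<close>

lemma half_darts_exist:
  obtains T where "T \<subseteq> D" "T \<inter> a ` T = {}" "T \<union> a ` T = D" "2 * card T = card D"
proof -
  define c where "c d = (SOME e. e \<in> {d, a d})" for d
  have c: "c d = d \<or> c d = a d" for d
    using someI_ex[of "\<lambda>e. e \<in> {d, a d}"] unfolding c_def by auto
  have ca: "c (a d) = c d" if "d \<in> D" for d
    using a_a[OF that] unfolding c_def by (simp add: insert_commute)
  let ?T = "{d \<in> D. c d = d}"
  have int: "?T \<inter> a ` ?T = {}"
    using ca a_ne by fastforce
  moreover have un: "?T \<union> a ` ?T = D"
  proof
    show "D \<subseteq> ?T \<union> a ` ?T"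
    proof
      fix d assume d: "d \<in> D"
      then show "d \<in> ?T \<union> a ` ?T"
        using c[of d] ca[OF d] a_closed[OF d] a_a[OF d] by (auto intro: image_eqI[where x = "a d"])
    qed
  qed (use a_closed in auto)
  moreover have "card (a ` ?T) = card ?T"
    using perm_a by (intro card_image) (auto simp: perm_on_def intro: inj_on_subset)
  then have "2 * card ?T = card D"
    using un int finite_darts card_Un_disjoint[of ?T "a ` ?T"] by simp
  ultimately show ?thesis using that[of ?T] by blast
qed

text \<open>This is \<open>V + F \<le> E + 2\<close>.  Starting from the rotation \<open>s\<close> alone, the edges are inserted one by one,
  each as a transposition.  The invariant compares the number of cycles of \<open>s\<close> and of the current
  product with the number of inserted edges and of connected components: a transposition adds at
  most one cycle, and if its edge joins two components, it joins two cycles as well.\<close>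

lemma euler_genus_bound:
  assumes conn: connected_map and ne: "D \<noteq> {}"
  shows "2 * (ncycles D s + ncycles D (s \<circ> a)) \<le> card D + 4"
proof -
  obtain T where T: "T \<subseteq> D" "T \<inter> a ` T = {}" "T \<union> a ` T = D" "2 * card T = card D"
    by (rule half_darts_exist)
  define p where "p S = (\<lambda>d. if d \<in> S \<union> a ` S then s (a d) else s d)" for S
  define E where "E S = fun_edges D s \<union> fun_edges S a" for S
  have finT: "finite T" using T finite_darts by (meson finite_subset)
  have E: "E S \<subseteq> D \<times> D" if "S \<subseteq> D" for S
    using that fun_edges_subset[OF perm_s] a_closed unfolding E_def by blast
  have mono: "E S \<subseteq> generated_equiv D (E S')" if "S \<subseteq> S'" "S' \<subseteq> D" for S S'
    using that generated_equiv_incl[OF E[OF that(2)]] unfolding E_def by blast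
  have "perm_on (p S) D \<and> fun_edges D (p S) \<subseteq> generated_equiv D (E S) \<and>
      ncycles D s + ncycles D (p S) \<le> card S + 2 * ncomp D (E S)" if "S \<subseteq> T" for S
    using finite_subset[OF that finT] that
  proof (induction S rule: finite_induct)
    case empty
    have "p {} = s" by (auto simp: p_def)
    moreover have "fun_edges D s \<subseteq> generated_equiv D (fun_edges D s)"
      by (rule generated_equiv_incl[OF fun_edges_subset[OF perm_s]])
    ultimately show ?case using perm_s by (simp add: E_def ncycles_def)
  next
    case (insert x S)
    then have S: "S \<subseteq> D" and x: "x \<in> T" "x \<in> D" "a x \<in> D" "a x \<noteq> x"
      using T(1) a_closed a_ne by auto
    have IH: "perm_on (p S) D" "fun_edges D (p S) \<subseteq> generated_equiv D (E S)"
      "ncycles D s + ncycles D (p S) \<le> card S + 2 * ncomp D (E S)"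
      using insert by auto
    have "a x \<notin> S" using x(1) insert.prems T(2) by auto
    moreover have "x \<notin> a ` S" using x(1) insert.prems T(2) by auto
    moreover have "a x \<notin> a ` S"
      using x S insert.hyps perm_a by (auto simp: perm_on_def inj_on_def)
    ultimately have out: "x \<notin> S \<union> a ` S" "a x \<notin> S \<union> a ` S" using insert.hyps by auto
    \<comment> \<open>inserting the edge of \<open>x\<close> composes the current product with one transposition\<close>
    have p: "p (insert x S) = (p S)(x := p S (a x), a x := p S x)"
      using out x a_a[OF x(2)] by (auto simp: p_def fun_eq_iff)
    have perm: "perm_on (p (insert x S)) D"
      unfolding p by (rule perm_on_fun_upd[OF IH(1)]) (use x in auto)
    have Eins: "E (insert x S) = insert (x, a x) (E S)" by (auto simp: E_def)
    have sub: "insert x S \<subseteq> D" using S x by auto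
    have "fun_edges D (p (insert x S)) \<subseteq> generated_equiv D (E (insert x S))"
    proof
      have mono': "generated_equiv D (E S) \<subseteq> generated_equiv D (E (insert x S))"
        by (rule generated_equiv_mono[OF mono]) (use sub in auto)
      let ?R = "generated_equiv D (E (insert x S))"
      have xax: "(x, a x) \<in> ?R" using generated_equiv_incl[OF E[OF sub]] Eins by auto
      have symR: "(c, b) \<in> ?R" if "(b, c) \<in> ?R" for b c
        using equiv_generated_equiv that by (meson equivE symD)
      have transR: "(b, e) \<in> ?R" if "(b, c) \<in> ?R" "(c, e) \<in> ?R" for b c e
        using equiv_generated_equiv that by (meson equivE transD)
      have old: "(d, p S d) \<in> ?R" if "d \<in> D" for d using IH(2) mono' that by blast
      fix z assume "z \<in> fun_edges D (p (insert x S))"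
      then obtain d where d: "d \<in> D" "z = (d, p (insert x S) d)" by blast
      consider "d = x" | "d = a x" | "d \<noteq> x" "d \<noteq> a x" by blast
      then show "z \<in> ?R"
      proof cases
        case 1
        then show ?thesis using d transR[OF xax old[OF x(3)]] x by (simp add: p)
      next
        case 2
        then show ?thesis using d transR[OF symR[OF xax] old[OF x(2)]] x by (simp add: p)
      next
        case 3
        then show ?thesis using d old[OF d(1)] by (simp add: p)
      qed
    qed
    moreover have "ncycles D s + ncycles D (p (insert x S)) \<le>
        card (insert x S) + 2 * ncomp D (E (insert x S))"
    proof (cases "(x, a x) \<in> generated_equiv D (E S)")
      case True
      then have "E (insert x S) \<subseteq> generated_equiv D (E S)"
        using Eins generated_equiv_incl[OF E[OF S]] by auto
      then have "ncomp D (E S) \<le> ncomp D (E (insert x S))"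
        by (rule ncomp_antimono[OF finite_darts])
      moreover have "ncycles D (p (insert x S)) \<le> ncycles D (p S) + 1"
        unfolding p by (rule ncycles_fun_upd_le[OF IH(1)]) (use x in auto)
      ultimately show ?thesis using IH(3) insert.hyps by simp
    next
      case False
      then have "(x, a x) \<notin> generated_equiv D (fun_edges D (p S))"
        using generated_equiv_mono[OF IH(2)] by blast
      then have "ncycles D (p (insert x S)) + 1 \<le> ncycles D (p S)"
        unfolding p by (intro ncycles_fun_upd_merge[OF IH(1)]) (use x in auto)
      moreover have "ncomp D (E S) \<le> ncomp D (E (insert x S)) + 1"
        unfolding Eins by (rule ncomp_insert_ge[OF finite_darts E[OF S]]) (use x in auto)
      ultimately show ?thesis using IH(3) insert.hyps by simp
    qed
    ultimately show ?case using perm by blast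
  qed
  then have bound: "ncycles D s + ncycles D (p T) \<le> card T + 2 * ncomp D (E T)" by blast
  have "fun_edges D (p T) = fun_edges D (s \<circ> a)"
    using T(3) by (auto simp: p_def)
  then have pT: "ncycles D (p T) = ncycles D (s \<circ> a)" by (simp add: ncycles_def)
  have "D // generated_equiv D (E T) = {D}"
  proof -
    let ?R = "generated_equiv D (E T)"
    have ER: "E T \<subseteq> ?R" by (rule generated_equiv_incl[OF E[OF T(1)]])
    have "?R `` {d} = D" if d: "d \<in> D" for d
    proof -
      let ?Z = "?R `` {d}"
      have sub: "?Z \<subseteq> D" by (auto simp: generated_equiv_def)
      have closed: "f z \<in> ?Z" if "z \<in> ?Z" "(z, f z) \<in> ?R" for f z
        using that equiv_generated_equiv by (metis Image_singleton_iff equivE transD)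
      have "s z \<in> ?Z" if "z \<in> ?Z" for z
        using closed[OF that, of s] ER sub that unfolding E_def by blast
      moreover have "a z \<in> ?Z" if z: "z \<in> ?Z" for z
      proof -
        have "z \<in> T \<or> a z \<in> T" using z sub T(3) a_a T(1) by force
        then have "(z, a z) \<in> E T \<or> (a z, z) \<in> E T"
          using a_a[of z] z sub unfolding E_def by force
        then have "(z, a z) \<in> ?R"
          using ER equiv_generated_equiv by (metis equivE symD subsetD)
        then show ?thesis using closed[OF z] by blast
      qed
      moreover have "d \<in> ?Z" by (rule equiv_class_self[OF equiv_generated_equiv d])
      ultimately have "s ` ?Z \<subseteq> ?Z" "a ` ?Z \<subseteq> ?Z" "?Z \<noteq> {}" by blast+
      then show "?Z = D"
        using conn sub unfolding connected_map_def by (metis (no_types, lifting))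
    qed
    then show ?thesis using ne unfolding quotient_def by auto
  qed
  then have "ncomp D (E T) = 1" by (simp add: ncomp_def)
  then show ?thesis using bound pT T(4) by simp
qed

text \<open>A nonempty closed set of darts of minimal size is connected.\<close>

lemma connected_submap_exists:
  assumes "D \<noteq> {}"
  obtains U where "U \<subseteq> D" "U \<noteq> {}" "combinatorial_map U s a" "combinatorial_map.connected_map U s a"
proof -
  define P where "P Z \<longleftrightarrow> Z \<subseteq> D \<and> Z \<noteq> {} \<and> s ` Z \<subseteq> Z \<and> a ` Z \<subseteq> Z" for Z
  have "P D" using assms perm_s a_closed by (auto simp: P_def perm_on_def)
  then obtain U where U: "P U" and min: "\<And>Z. P Z \<Longrightarrow> card U \<le> card Z"
    using ex_has_least_nat[of P D card] by blast
  have map: "combinatorial_map U s a"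
  proof
    show "perm_on s U" using perm_on_subset[OF perm_s, of U] U by (simp add: P_def)
  qed (use U a_a a_ne in \<open>auto simp: P_def\<close>)
  have "Z = U" if "Z \<subseteq> U" "Z \<noteq> {}" "s ` Z \<subseteq> Z" "a ` Z \<subseteq> Z" for Z
  proof -
    have "P Z" using that U by (auto simp: P_def)
    then have "card U \<le> card Z" by (rule min)
    moreover have "finite U" using U finite_darts finite_subset by (auto simp: P_def)
    ultimately show ?thesis using that(1) by (simp add: card_seteq)
  qed
  then have "combinatorial_map.connected_map U s a"
    unfolding combinatorial_map.connected_map_def[OF map] by blast
  then show ?thesis using that[of U] U map by (simp add: P_def)
qed

end

section \<open>Coverings of combinatorial maps\<close>

text \<open>Equivariance and connectedness of the base make all fibres of \<open>\<pi>\<close> equally large.  On a cycle,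
  \<open>\<pi>\<close> may be a branched covering: it may wind a cell several times around its image.\<close>

locale map_covering = base: combinatorial_map D s a + top: combinatorial_map E t b
  for D :: "'a set" and s a and E :: "'b set" and t b +
  fixes \<pi> :: "'b \<Rightarrow> 'a"
  assumes \<pi>_in: "e \<in> E \<Longrightarrow> \<pi> e \<in> D"
    and \<pi>_vertex: "e \<in> E \<Longrightarrow> \<pi> (t e) = s (\<pi> e)"
    and \<pi>_edge: "e \<in> E \<Longrightarrow> \<pi> (b e) = a (\<pi> e)"
    and base_connected: base.connected_map
    and top_nonempty: "E \<noteq> {}"
begin

text \<open>The common size of the fibres.  A quotient of cardinalities can be defined before the fibres are
  known to be equally large.\<close>

definition degree :: nat where
  "degree = card E div card D"

lemma fibre_step:
  assumes f: "perm_on f D" and g: "perm_on g E" and d: "d \<in> D"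
    and \<pi>: "\<And>e. e \<in> E \<Longrightarrow> \<pi> (g e) = f (\<pi> e)"
  shows "card {e \<in> E. \<pi> e = f d} = card {e \<in> E. \<pi> e = d}"
proof -
  have "g ` {e \<in> E. \<pi> e = d} = {e \<in> E. \<pi> e = f d}"
  proof
    show "g ` {e \<in> E. \<pi> e = d} \<subseteq> {e \<in> E. \<pi> e = f d}"
      using g \<pi> by (auto simp: perm_on_def)
    show "{e \<in> E. \<pi> e = f d} \<subseteq> g ` {e \<in> E. \<pi> e = d}"
    proof
      fix e assume e: "e \<in> {e \<in> E. \<pi> e = f d}"
      then obtain e' where e': "e' \<in> E" "e = g e'" using perm_on_image_eq[OF g] by blast
      then have "f (\<pi> e') = f d" using \<pi> e by auto
      then have "\<pi> e' = d" using f d \<pi>_in[OF e'(1)] by (auto simp: perm_on_def inj_on_def)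
      then show "e \<in> g ` {e \<in> E. \<pi> e = d}" using e' by blast
    qed
  qed
  moreover have "inj_on g {e \<in> E. \<pi> e = d}"
    using g by (auto simp: perm_on_def intro: inj_on_subset)
  ultimately show ?thesis using card_image[of g "{e \<in> E. \<pi> e = d}"] by (simp only:)
qed

lemma card_fibre_eq:
  assumes "d \<in> D" "d' \<in> D"
  shows "card {e \<in> E. \<pi> e = d} = card {e \<in> E. \<pi> e = d'}"
proof -
  let ?Z = "{z \<in> D. card {e \<in> E. \<pi> e = z} = card {e \<in> E. \<pi> e = d}}"
  have "s ` ?Z \<subseteq> ?Z"
    using fibre_step[OF base.perm_s top.perm_s _ \<pi>_vertex] base.perm_s
    by (auto simp: perm_on_def)
  moreover have "a ` ?Z \<subseteq> ?Z"
    using fibre_step[OF base.perm_a top.perm_a _ \<pi>_edge] base.a_closed by auto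
  moreover have "?Z \<subseteq> D" "?Z \<noteq> {}" using assms by blast+
  ultimately have "?Z = D"
    using base_connected unfolding base.connected_map_def by (metis (no_types, lifting))
  then have "d' \<in> ?Z" using assms(2) by (rule ssubst)
  then show ?thesis by simp
qed

lemma sum_over_base:
  fixes F :: "'a \<Rightarrow> real"
  shows "(\<Sum>e\<in>E. F (\<pi> e)) = real degree * (\<Sum>d\<in>D. F d)"
    and card_fibre: "d \<in> D \<Longrightarrow> card {e \<in> E. \<pi> e = d} = degree"
    and card_top: "card E = degree * card D"
    and degree_pos: "degree > 0"
proof -
  obtain e0 where e0: "e0 \<in> E" using top_nonempty by blast
  define h where "h = card {e \<in> E. \<pi> e = \<pi> e0}"
  have h: "card {e \<in> E. \<pi> e = d} = h" if dD: "d \<in> D" for d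
    unfolding h_def using that \<pi>_in[OF e0] by (rule card_fibre_eq)
  have img: "\<pi> ` E \<subseteq> D" using \<pi>_in by blast
  have sum: "(\<Sum>e\<in>E. F (\<pi> e)) = real h * (\<Sum>d\<in>D. F d)" for F :: "'a \<Rightarrow> real"
  proof -
    have "(\<Sum>e\<in>E. F (\<pi> e)) = (\<Sum>d\<in>D. \<Sum>e\<in>{e \<in> E. \<pi> e = d}. F (\<pi> e))"
      by (rule sum.group[OF top.finite_darts base.finite_darts img, symmetric])
    also have "\<dots> = (\<Sum>d\<in>D. \<Sum>e\<in>{e \<in> E. \<pi> e = d}. F d)"
      by (intro sum.cong refl) auto
    also have "\<dots> = (\<Sum>d\<in>D. real h * F d)"
      by (intro sum.cong refl) (simp add: h)
    finally show ?thesis by (simp add: sum_distrib_left)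
  qed
  have "real (card E) = real (h * card D)"
    using sum[of "\<lambda>_. 1"] by simp
  then have cardE: "card E = h * card D" using of_nat_eq_iff by blast
  have "card D > 0" using \<pi>_in[OF e0] base.finite_darts by (auto simp: card_gt_0_iff)
  then have deg: "degree = h" using cardE by (simp add: degree_def)
  show "(\<Sum>e\<in>E. F (\<pi> e)) = real degree * (\<Sum>d\<in>D. F d)" using sum deg by simp
  show "d \<in> D \<Longrightarrow> card {e \<in> E. \<pi> e = d} = degree" using h deg by simp
  show "card E = degree * card D" using cardE deg by simp
  show "degree > 0"
    using e0 top.finite_darts deg unfolding h_def by (auto simp: card_gt_0_iff)
qed

lemma fibre_nonempty:
  assumes "d \<in> D"
  obtains e where "e \<in> E" "\<pi> e = d"
proof -
  have "card {e \<in> E. \<pi> e = d} > 0" using card_fibre[OF assms] degree_pos by simp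
  then show ?thesis using that by (auto simp: card_gt_0_iff)
qed

text \<open>The cycle of \<open>e\<close> lies over the cycle of \<open>\<pi> e\<close>, and every fibre has \<open>degree\<close> elements.\<close>

lemma cycle_length_le_degree_times:
  assumes f: "perm_on f D" and g: "perm_on g E" and e: "e \<in> E"
    and \<pi>: "\<And>e. e \<in> E \<Longrightarrow> \<pi> (g e) = f (\<pi> e)"
  shows "cycle_length E g e \<le> degree * cycle_length D f (\<pi> e)"
proof -
  let ?C = "cycle_of_elem D f (\<pi> e)"
  have pow: "\<pi> ((g ^^ n) e) = (f ^^ n) (\<pi> e)" for n
    by (induction n) (use \<pi> perm_on_funpow[OF g e] in auto)
  have finC: "finite ?C"
    using cycle_of_elem_subset base.finite_darts by (rule finite_subset)
  have "cycle_of_elem E g e \<subseteq> (\<Union>d\<in>?C. {e' \<in> E. \<pi> e' = d})"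
    using perm_on_funpow[OF g e] pow
    unfolding cycle_of_elem_eq_orbit[OF g e] cycle_of_elem_eq_orbit[OF f \<pi>_in[OF e]] by auto
  then have "cycle_length E g e \<le> card (\<Union>d\<in>?C. {e' \<in> E. \<pi> e' = d})"
    unfolding cycle_length_def by (rule card_mono[rotated]) (use finC top.finite_darts in auto)
  also have "\<dots> \<le> (\<Sum>d\<in>?C. card {e' \<in> E. \<pi> e' = d})"
    by (rule card_UN_le[OF finC])
  also have "\<dots> = (\<Sum>d\<in>?C. degree)"
  proof (rule sum.cong[OF refl])
    fix d assume "d \<in> ?C"
    then have "d \<in> D" by (rule subsetD[OF cycle_of_elem_subset])
    then show "card {e' \<in> E. \<pi> e' = d} = degree" by (rule card_fibre)
  qed
  finally show ?thesis by (simp add: cycle_length_def mult.commute)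
qed

end

section \<open>The fibre product with a Platonic solid\<close>

text \<open>The last condition is Euler's formula \<open>V - E + F = 2\<close>, expressed in the number of darts.\<close>

definition regular_sphere_map :: "nat \<Rightarrow> nat \<Rightarrow> 'a set \<Rightarrow> ('a \<Rightarrow> 'a) \<Rightarrow> ('a \<Rightarrow> 'a) \<Rightarrow> bool" where
  "regular_sphere_map k l X t b \<longleftrightarrow> X \<noteq> {} \<and> combinatorial_map X t b \<and>
     combinatorial_map.connected_map X t b \<and>
     (\<forall>x\<in>X. cycle_length X t x = k \<and> cycle_length X (t \<circ> b) x = l) \<and>
     real (card X) * (1 / real k + 1 / real l - 1 / 2) = 2"

context combinatorial_map
begin

text \<open>The common covering of the map and of \<open>X\<close> is a connected part of the product.  Its cells have the
  length of a least common multiple.  Only the numerical consequences are recorded: the degrees \<open>h\<close>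
  and \<open>n\<close> of the two coverings, the bound \<open>V - E + F \<le> 2\<close> as a sum over the darts of the base, and
  the fact that a cell has at most as many darts as lie over its two images.\<close>

lemma common_cover_with_regular:
  assumes conn: connected_map and ne: "D \<noteq> {}" and X: "regular_sphere_map k l X t b"
  obtains h n :: nat where "h > 0" "n > 0" "h * card D = n * card X"
    "real h * (\<Sum>d\<in>D. 1 / real (lcm (cycle_length D s d) k) +
      1 / real (lcm (cycle_length D (s \<circ> a) d) l) - 1 / 2) \<le> 2"
    "\<And>d. d \<in> D \<Longrightarrow> lcm (cycle_length D s d) k \<le> h * cycle_length D s d"
    "\<And>d. d \<in> D \<Longrightarrow> lcm (cycle_length D s d) k \<le> n * k"
    "\<And>d. d \<in> D \<Longrightarrow> lcm (cycle_length D (s \<circ> a) d) l \<le> h * cycle_length D (s \<circ> a) d"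
    "\<And>d. d \<in> D \<Longrightarrow> lcm (cycle_length D (s \<circ> a) d) l \<le> n * l"
proof -
  interpret X: combinatorial_map X t b
    using X by (simp add: regular_sphere_map_def)
  have Xne: "X \<noteq> {}" and Xconn: X.connected_map
    and Xlen: "\<And>x. x \<in> X \<Longrightarrow> cycle_length X t x = k" "\<And>x. x \<in> X \<Longrightarrow> cycle_length X (t \<circ> b) x = l"
    using X by (auto simp: regular_sphere_map_def)
  let ?s = "map_prod s t" and ?a = "map_prod a b"
  interpret P: combinatorial_map "D \<times> X" ?s ?a
    by standard
       (use perm_on_map_prod[OF perm_s X.perm_s] a_closed X.a_closed a_a X.a_a a_ne X.a_ne in auto)
  obtain U where U: "U \<subseteq> D \<times> X" "U \<noteq> {}" "combinatorial_map U ?s ?a"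
    "combinatorial_map.connected_map U ?s ?a"
    using P.connected_submap_exists ne Xne by (metis Times_empty)
  interpret U: combinatorial_map U ?s ?a by (rule U(3))
  interpret c1: map_covering D s a U ?s ?a fst
    by standard (use U conn in auto)
  interpret c2: map_covering X t b U ?s ?a snd
    by standard (use U Xconn in auto)
  have face: "?s \<circ> ?a = map_prod (s \<circ> a) (t \<circ> b)" by (simp add: map_prod_compose)
  have lens: "cycle_length U ?s e = lcm (cycle_length D s (fst e)) k"
    "cycle_length U (?s \<circ> ?a) e = lcm (cycle_length D (s \<circ> a) (fst e)) l" if eU: "e \<in> U" for e
  proof -
    obtain d x where e: "e = (d, x)" "d \<in> D" "x \<in> X"
      using eU U(1) by (cases e) auto
    show "cycle_length U ?s e = lcm (cycle_length D s (fst e)) k"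
      using cycle_length_map_prod[OF perm_s X.perm_s U.perm_s] eU e Xlen by simp
    show "cycle_length U (?s \<circ> ?a) e = lcm (cycle_length D (s \<circ> a) (fst e)) l"
      using cycle_length_map_prod[OF perm_face X.perm_face U.perm_face[unfolded face]] eU e Xlen
      unfolding face by simp
  qed
  have "real (2 * (ncycles U ?s + ncycles U (?s \<circ> ?a))) \<le> real (card U + 4)"
    using U.euler_genus_bound[OF U(4,2)] of_nat_le_iff by blast
  then have "real (ncycles U ?s) + real (ncycles U (?s \<circ> ?a)) - real (card U) / 2 \<le> 2" by simp
  also have "real (ncycles U ?s) + real (ncycles U (?s \<circ> ?a)) - real (card U) / 2 =
      (\<Sum>e\<in>U. 1 / real (cycle_length U ?s e) + 1 / real (cycle_length U (?s \<circ> ?a) e) - 1 / 2)"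
    by (simp add: ncycles_eq_sum[OF U.finite_darts] sum.distrib sum_subtractf)
  also have "\<dots> = (\<Sum>e\<in>U. 1 / real (lcm (cycle_length D s (fst e)) k) +
      1 / real (lcm (cycle_length D (s \<circ> a) (fst e)) l) - 1 / 2)"
    by (intro sum.cong refl) (simp only: lens)
  also have "\<dots> = real c1.degree * (\<Sum>d\<in>D. 1 / real (lcm (cycle_length D s d) k) +
      1 / real (lcm (cycle_length D (s \<circ> a) d) l) - 1 / 2)"
    by (rule c1.sum_over_base)
  finally have euler: "real c1.degree * (\<Sum>d\<in>D. 1 / real (lcm (cycle_length D s d) k) +
      1 / real (lcm (cycle_length D (s \<circ> a) d) l) - 1 / 2) \<le> 2" .
  have bounds: "lcm (cycle_length D s d) k \<le> c1.degree * cycle_length D s d \<and>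
      lcm (cycle_length D s d) k \<le> c2.degree * k \<and>
      lcm (cycle_length D (s \<circ> a) d) l \<le> c1.degree * cycle_length D (s \<circ> a) d \<and>
      lcm (cycle_length D (s \<circ> a) d) l \<le> c2.degree * l" if dD: "d \<in> D" for d
  proof -
    obtain e where e: "e \<in> U" "fst e = d" using c1.fibre_nonempty[OF dD] by blast
    then have x: "snd e \<in> X" using U(1) by auto
    have "cycle_length U ?s e \<le> c1.degree * cycle_length D s (fst e)"
      by (rule c1.cycle_length_le_degree_times[OF perm_s U.perm_s e(1)]) auto
    moreover have "cycle_length U (?s \<circ> ?a) e \<le> c1.degree * cycle_length D (s \<circ> a) (fst e)"
      by (rule c1.cycle_length_le_degree_times[OF perm_face U.perm_face e(1)]) auto
    moreover have "cycle_length U ?s e \<le> c2.degree * cycle_length X t (snd e)"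
      by (rule c2.cycle_length_le_degree_times[OF X.perm_s U.perm_s e(1)]) auto
    moreover have "cycle_length U (?s \<circ> ?a) e \<le> c2.degree * cycle_length X (t \<circ> b) (snd e)"
      by (rule c2.cycle_length_le_degree_times[OF X.perm_face U.perm_face e(1)]) auto
    ultimately show ?thesis using lens[OF e(1)] e(2) Xlen[OF x] by simp
  qed
  have "c1.degree * card D = c2.degree * card X"
    using c1.card_top c2.card_top by simp
  then show ?thesis
    using that[of c1.degree c2.degree] c1.degree_pos c2.degree_pos euler bounds by blast
qed

end

section \<open>The regular maps on the sphere\<close>

text \<open>Rotation around faces and rotation around vertices exchange their roles, since
  \<open>(t \<circ> b) \<circ> b\<close> is \<open>t\<close> again.\<close>

lemma regular_sphere_map_dual:
  assumes "regular_sphere_map k l X t b"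
  shows "regular_sphere_map l k X (t \<circ> b) b"
proof -
  interpret X: combinatorial_map X t b
    using assms by (simp add: regular_sphere_map_def)
  interpret Y: combinatorial_map X "t \<circ> b" b
    by standard (use X.perm_face X.a_closed X.a_a X.a_ne in auto)
  have "Y.connected_map"
    unfolding Y.connected_map_def
  proof (intro allI impI)
    fix Z assume Z: "Z \<subseteq> X" "Z \<noteq> {}" "(t \<circ> b) ` Z \<subseteq> Z" "b ` Z \<subseteq> Z"
    have "t z \<in> Z" if "z \<in> Z" for z
    proof -
      have "(t \<circ> b) (b z) \<in> Z" using that Z by blast
      then show ?thesis using that Z(1) X.a_a[of z] by auto
    qed
    then have "t ` Z \<subseteq> Z" by blast
    moreover have X.connected_map using assms by (simp add: regular_sphere_map_def)
    ultimately show "Z = X" using Z unfolding X.connected_map_def by blast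
  qed
  moreover have "cycle_length X ((t \<circ> b) \<circ> b) x = cycle_length X t x" for x
    by (rule cycle_length_cong) (simp add: X.a_a)
  ultimately show ?thesis
    using assms Y.combinatorial_map_axioms by (simp add: regular_sphere_map_def add.commute)
qed

text \<open>The number \<open>m\<close> is a common multiple of the proper divisors of \<open>l\<close>, so that a single inequality
  excludes them all; for a prime \<open>l\<close> one can take \<open>m = 1\<close>.\<close>

lemma cycle_length_eq_by_divisors:
  assumes f: "perm_on f Y" and y: "y \<in> Y" and l: "l > 0" "(f ^^ l) y = y" "(f ^^ m) y \<noteq> y"
    and m: "\<And>j. j dvd l \<Longrightarrow> j < l \<Longrightarrow> j dvd m"
  shows "cycle_length Y f y = l"
proof -
  have "cycle_length Y f y dvd l" "\<not> cycle_length Y f y dvd m"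
    using l(2,3) funpow_fixed_iff_dvd[OF f y] by blast+
  then show ?thesis using m[of "cycle_length Y f y"] l(1) dvd_imp_le by fastforce
qed

text \<open>The equator with \<open>l\<close> vertices of degree 2 and two faces of degree \<open>l\<close>.  The dart \<open>i < l\<close> leads from
  vertex \<open>i\<close> to vertex \<open>i + 1\<close> modulo \<open>l\<close>, and \<open>i + l\<close> is its reverse.\<close>

lemma regular_dihedral_map:
  fixes l :: nat
  assumes l: "l \<ge> 2"
  defines "b \<equiv> \<lambda>i::int. if i < int l then i + int l else i - int l"
    and "t \<equiv> \<lambda>i::int. if i < int l then int l + (i - 1) mod int l else (i - int l + 1) mod int l"
  shows "regular_sphere_map 2 l {0..<2 * int l} t b"
proof -
  let ?l = "int l"
  let ?X = "{0..<2 * ?l}"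
  have lpos: "?l > 0" using l by simp
  have mods: "0 \<le> i mod ?l" "i mod ?l < ?l" for i using lpos by simp_all
  have tX: "t i \<in> ?X" for i using mods[of "i - 1"] mods[of "i - ?l + 1"] unfolding t_def by auto
  have bX: "b i \<in> ?X" if "i \<in> ?X" for i using that unfolding b_def by auto
  have tt: "t (t i) = i" if "i \<in> ?X" for i
  proof (cases "i < ?l")
    case True
    then have "t (t i) = ((i - 1) mod ?l + 1) mod ?l"
      using mods[of "i - 1"] by (simp add: t_def)
    also have "\<dots> = i" using True that by (simp add: mod_add_left_eq)
    finally show ?thesis .
  next
    case False
    then have "t (t i) = ?l + ((i - ?l + 1) mod ?l - 1) mod ?l"
      using mods[of "i - ?l + 1"] by (simp add: t_def)
    also have "\<dots> = ?l + (i - ?l) mod ?l" by (simp add: mod_diff_left_eq)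
    also have "\<dots> = i" using False that by (simp add: mod_pos_pos_trivial del: minus_mod_self2)
    finally show ?thesis .
  qed
  have t_ne: "t i \<noteq> i" for i
  proof (cases "i < ?l")
    case True
    then have "t i = ?l + (i - 1) mod ?l" by (simp add: t_def)
    then show ?thesis using mods(1)[of "i - 1"] True by linarith
  next
    case False
    then have "t i = (i - ?l + 1) mod ?l" by (simp add: t_def)
    then show ?thesis using mods(2)[of "i - ?l + 1"] False by linarith
  qed
  have bb: "b (b i) = i" "b i \<noteq> i" if "i \<in> ?X" for i
    using that lpos unfolding b_def by auto
  have perm_t: "perm_on t ?X"
    unfolding perm_on_def using tX by (auto intro!: inj_on_inverseI[where g = t] simp: tt)
  interpret combinatorial_map ?X t b
    by standard (use perm_t bX bb in auto)
  have face: "((t \<circ> b) ^^ n) i =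
      (if i < ?l then (i + int n) mod ?l else ?l + (i - ?l - int n) mod ?l)" if "i \<in> ?X" for n i
  proof (induction n)
    case 0
    then show ?case using that by (auto simp del: minus_mod_self2)
  next
    case (Suc n)
    show ?case
    proof (cases "i < ?l")
      case True
      have "((t \<circ> b) ^^ Suc n) i = t (b (((t \<circ> b) ^^ n) i))" by simp
      also have "((t \<circ> b) ^^ n) i = (i + int n) mod ?l"
        unfolding Suc using True by (rule if_P)
      also have "t (b \<dots>) = t ((i + int n) mod ?l + ?l)"
        using mods(2)[of "i + int n"] by (simp add: b_def)
      also have "\<dots> = ((i + int n) mod ?l + 1) mod ?l"
        using mods[of "i + int n"] by (simp add: t_def)
      also have "\<dots> = (i + int (Suc n)) mod ?l" by (simp add: mod_simps algebra_simps)
      finally show ?thesis using True by simp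
    next
      case False
      have "((t \<circ> b) ^^ Suc n) i = t (b (((t \<circ> b) ^^ n) i))" by simp
      also have "((t \<circ> b) ^^ n) i = ?l + (i - ?l - int n) mod ?l"
        unfolding Suc using False by (rule if_not_P)
      also have "t (b \<dots>) = t ((i - ?l - int n) mod ?l)"
        using mods(1)[of "i - ?l - int n"] by (simp add: b_def)
      also have "\<dots> = ?l + ((i - ?l - int n) mod ?l - 1) mod ?l"
        using mods[of "i - ?l - int n"] by (simp add: t_def)
      also have "((i - ?l - int n) mod ?l - 1) mod ?l = (i - ?l - int n - 1) mod ?l"
        by (rule mod_diff_left_eq)
      finally show ?thesis using False by (simp add: algebra_simps)
    qed
  qed
  have face_length: "cycle_length ?X (t \<circ> b) i = l" if i: "i \<in> ?X" for i
  proof (rule cycle_length_eqI[OF perm_face i])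
    fix n
    show "((t \<circ> b) ^^ n) i = i \<longleftrightarrow> l dvd n"
    proof (cases "i < ?l")
      case True
      then have "((t \<circ> b) ^^ n) i = i \<longleftrightarrow> (i + int n) mod ?l = i mod ?l"
        using face[OF i] i by simp
      also have "\<dots> \<longleftrightarrow> ?l dvd int n" by (simp add: mod_eq_dvd_iff)
      finally show ?thesis by simp
    next
      case False
      then have "((t \<circ> b) ^^ n) i = i \<longleftrightarrow> (i - ?l - int n) mod ?l = (i - ?l) mod ?l"
        using face[OF i] i by (auto simp del: minus_mod_self2)
      also have "\<dots> \<longleftrightarrow> ?l dvd int n" by (simp add: mod_eq_dvd_iff del: minus_mod_self2)
      finally show ?thesis by simp
    qed
  qed
  have vertex_length: "cycle_length ?X t i = 2" if i: "i \<in> ?X" for i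
  proof (rule cycle_length_eq_by_divisors[OF perm_t i, where m = 1])
    show "(t ^^ 2) i = i" "(t ^^ 1) i \<noteq> i" using tt[OF i] t_ne[of i] by (simp_all add: numeral_2_eq_2)
    show "j dvd 1" if "j dvd 2" "j < 2" for j :: nat
      using that by (cases j) auto
  qed auto
  have connected_map
    unfolding connected_map_def
  proof (intro allI impI)
    fix Z assume Z: "Z \<subseteq> ?X" "Z \<noteq> {}" "t ` Z \<subseteq> Z" "b ` Z \<subseteq> Z"
    have pow: "((t \<circ> b) ^^ n) z \<in> Z" if "z \<in> Z" for n z
    proof (induction n)
      case (Suc n)
      then have "b (((t \<circ> b) ^^ n) z) \<in> Z" using Z(4) by blast
      then have "t (b (((t \<circ> b) ^^ n) z)) \<in> Z" using Z(3) by blast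
      moreover have "((t \<circ> b) ^^ Suc n) z = t (b (((t \<circ> b) ^^ n) z))" by simp
      ultimately show ?case by (rule ssubst[rotated])
    qed (simp add: that)
    obtain z0 where z0: "z0 \<in> Z" using Z by blast
    obtain z where z: "z \<in> Z" "z < ?l" "0 \<le> z"
    proof (cases "z0 < ?l")
      case True
      then show ?thesis using that[of z0] z0 Z(1) by auto
    next
      case False
      have "b z0 \<in> Z" using z0 Z(4) by blast
      then show ?thesis using that[of "b z0"] z0 Z(1) False by (auto simp: b_def)
    qed
    have small: "i \<in> Z" if "0 \<le> i" "i < ?l" for i
    proof -
      have "((t \<circ> b) ^^ nat ((i - z) mod ?l)) z = (z + (i - z) mod ?l) mod ?l"
        using face[of z "nat ((i - z) mod ?l)"] z mods[of "i - z"] by simp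
      also have "\<dots> = (z + (i - z)) mod ?l" by (rule mod_add_right_eq)
      also have "\<dots> = i" using that by simp
      finally show ?thesis using pow[OF z(1)] by metis
    qed
    have "i \<in> Z" if "i \<in> ?X" for i
    proof (cases "i < ?l")
      case False
      then have "b (i - ?l) \<in> Z" using small[of "i - ?l"] that Z(4) by auto
      then show ?thesis using that False by (simp add: b_def)
    qed (use that small in auto)
    then show "Z = ?X" using Z(1) by blast
  qed
  moreover have "real (card ?X) * (1 / real 2 + 1 / real l - 1 / 2) = 2"
    using l by (simp add: nat_mult_distrib)
  ultimately show ?thesis
    unfolding regular_sphere_map_def
    using combinatorial_map_axioms face_length vertex_length lpos by auto
qed

text \<open>In a cubic map, the darts leaving the vertex number \<open>v\<close> are \<open>3 v\<close>, \<open>3 v + 1\<close> and \<open>3 v + 2\<close>, in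
  cyclic order, so that the map is determined by its reversal of darts.\<close>

definition next_third :: "int \<Rightarrow> int" where
  "next_third i = (if i mod 3 = 2 then i - 2 else i + 1)"

text \<open>The condition \<open>b x < x\<close> for the first dart of every vertex but the first one says that this
  dart leads to a vertex with a smaller number, as in a breadth-first numbering.  These darts form a
  spanning tree, which is why the map is connected.\<close>

lemma regular_cubic_map:
  fixes N :: int and b :: "int \<Rightarrow> int"
  assumes N: "0 < N" "3 dvd N"
    and b: "\<And>x. x \<in> {0..<N} \<Longrightarrow> b x \<in> {0..<N} \<and> b x \<noteq> x \<and> b (b x) = x"
    and tree: "\<And>x. x \<in> {0..<N} \<Longrightarrow> x mod 3 = 0 \<Longrightarrow> 0 < x \<Longrightarrow> b x < x"
    and face: "\<And>x. x \<in> {0..<N} \<Longrightarrow> ((next_third \<circ> b) ^^ l) x = x \<and> ((next_third \<circ> b) ^^ m) x \<noteq> x"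
    and l: "0 < l" "\<And>j. j dvd l \<Longrightarrow> j < l \<Longrightarrow> j dvd m"
    and total: "real (nat N) * (1 / 3 + 1 / real l - 1 / 2) = 2"
  shows "regular_sphere_map 3 l {0..<N} next_third b"
proof -
  let ?X = "{0..<N}"
  have nX: "next_third x \<in> ?X" if "x \<in> ?X" for x
  proof -
    obtain q where q: "N = 3 * q" using N(2) by blast
    show ?thesis using that unfolding next_third_def q atLeastLessThan_iff
      by (cases "x mod 3 = 2") presburger+
  qed
  have n3: "next_third (next_third (next_third x)) = x" for x
  proof -
    have "(x + 1) mod 3 = 1" "(x + 2) mod 3 = 2" if "x mod 3 = 0" using that by presburger+
    moreover have "(x + 1) mod 3 = 2" "(x - 1) mod 3 = 0" if "x mod 3 = 1" using that by presburger+
    moreover have "(x - 2) mod 3 = 0" "(x - 1) mod 3 = 1" if "x mod 3 = 2" using that by presburger+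
    moreover have "x mod 3 = 0 \<or> x mod 3 = 1 \<or> x mod 3 = 2" by presburger
    ultimately show ?thesis by (elim disjE) (simp_all add: next_third_def add.assoc)
  qed
  have perm: "perm_on next_third ?X"
    unfolding perm_on_def
  proof (intro conjI)
    show "inj_on next_third ?X"
      by (rule inj_on_inverseI[where g = "\<lambda>x. next_third (next_third x)"]) (rule n3)
  qed (use nX in auto)
  interpret combinatorial_map ?X next_third b
    by standard (use perm b in auto)
  have "cycle_length ?X next_third x = 3" if x: "x \<in> ?X" for x
  proof (rule cycle_length_eq_by_divisors[OF perm x, where m = 1])
    show "(next_third ^^ 3) x = x" using n3 by (simp add: numeral_3_eq_3)
    show "(next_third ^^ 1) x \<noteq> x" by (simp add: next_third_def)
    show "j dvd 1" if "j dvd 3" "j < 3" for j :: nat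
    proof -
      have "j = 0 \<or> j = 1 \<or> j = 2" using that(2) by auto
      then show ?thesis using that(1) by auto
    qed
  qed auto
  moreover have "cycle_length ?X (next_third \<circ> b) x = l" if x: "x \<in> ?X" for x
    using cycle_length_eq_by_divisors[OF perm_face x l(1) _ _ l(2)] face[OF x] by blast
  moreover have connected_map
    unfolding connected_map_def
  proof (intro allI impI)
    fix Z assume Z: "Z \<subseteq> ?X" "Z \<noteq> {}" "next_third ` Z \<subseteq> Z" "b ` Z \<subseteq> Z"
    have n: "next_third x \<in> Z \<longleftrightarrow> x \<in> Z" for x
      using Z(3) n3[of x] by (metis image_subset_iff)
    have bZ: "b x \<in> Z \<longleftrightarrow> x \<in> Z" if "x \<in> ?X" for x
      using Z(4) b[OF that] by (metis image_subset_iff)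
    have pred: "(x - 1 \<in> Z \<longleftrightarrow> x \<in> Z)" if "x mod 3 \<noteq> 0" for x
    proof -
      have "next_third (x - 1) = x" using that unfolding next_third_def by presburger
      then show ?thesis using n[of "x - 1"] by simp
    qed
    have "int x \<in> Z \<longleftrightarrow> 0 \<in> Z" if "int x < N" for x :: nat
      using that
    proof (induction x rule: less_induct)
      case (less x)
      show ?case
      proof (cases "int x mod 3 = 0")
        case False
        then have "x > 0" by (cases x) auto
        then show ?thesis
          using less.IH[of "x - 1"] less.prems pred[OF False] by (simp add: of_nat_diff)
      next
        case True
        show ?thesis
        proof (cases "x = 0")
          case False
          then have x: "int x \<in> ?X" "0 < int x" using less.prems by auto
          then have "b (int x) < int x" "0 \<le> b (int x)" using tree True b by auto
          then have "b (int x) \<in> Z \<longleftrightarrow> 0 \<in> Z"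
            using less.IH[of "nat (b (int x))"] less.prems by auto
          then show ?thesis using bZ[OF x(1)] by simp
        qed simp
      qed
    qed
    then have all: "x \<in> Z \<longleftrightarrow> 0 \<in> Z" if "x \<in> ?X" for x
      using that by (metis atLeastLessThan_iff zero_le_imp_eq_int)
    then have "0 \<in> Z" using Z(1,2) by blast
    then show "Z = ?X" using all Z(1) by blast
  qed
  ultimately show ?thesis
    unfolding regular_sphere_map_def
    using combinatorial_map_axioms N total by auto
qed

text \<open>This equation yields all entries of a table at once.\<close>

lemma map_nth_upto: "map (\<lambda>x. xs ! nat x) [0..int (length xs) - 1] = xs"
  by (rule nth_equalityI) (auto simp: nth_upto)

text \<open>The tables list the reverses of the darts \<open>0, 1, 2, \<dots>\<close> for a breadth-first numbering of the
  vertices of the tetrahedron, the cube and the dodecahedron.\<close>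

definition tetrahedron_edges :: "int \<Rightarrow> int" where
  "tetrahedron_edges x = [3, 6, 9, 0, 11, 7, 1, 5, 10, 2, 8, 4] ! nat x"

definition cube_edges :: "int \<Rightarrow> int" where
  "cube_edges x = [3, 6, 9, 0, 12, 15, 1, 17, 18, 2, 20, 13, 4, 11, 21, 5, 23, 7, 8, 22, 10, 14,
     19, 16] ! nat x"

definition dodecahedron_edges :: "int \<Rightarrow> int" where
  "dodecahedron_edges x = [3, 6, 9, 0, 12, 15, 1, 18, 21, 2, 24, 27, 4, 29, 30, 5, 33, 19, 7, 17,
     36, 8, 39, 25, 10, 23, 42, 11, 45, 13, 14, 48, 34, 16, 32, 51, 20, 53, 40, 22, 38, 54, 26, 56,
     46, 28, 44, 49, 31, 47, 57, 35, 59, 37, 41, 58, 43, 50, 55, 52] ! nat x"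

lemma upto_11: "[0..11::int] = [0,1,2,3,4,5,6,7,8,9,10,11]"
  by (simp add: upto_rec1)

lemma upto_23: "[0..23::int] = [0,1,2,3,4,5,6,7,8,9,10,11,12,13,14,15,16,17,18,19,20,21,22,23]"
  by (simp add: upto_rec1)

lemma upto_59: "[0..59::int] = [0,1,2,3,4,5,6,7,8,9,10,11,12,13,14,15,16,17,18,19,20,21,22,23,24,25,
    26,27,28,29,30,31,32,33,34,35,36,37,38,39,40,41,42,43,44,45,46,47,48,49,50,51,52,53,54,55,56,57,
    58,59]"
  by (simp add: upto_rec1)

lemma map_tetrahedron_edges: "map tetrahedron_edges [0..11] = [3, 6, 9, 0, 11, 7, 1, 5, 10, 2, 8, 4]"
  using map_nth_upto[of "[3, 6, 9, 0, 11, 7, 1, 5, 10, 2, 8, 4::int]"]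
  unfolding tetrahedron_edges_def by simp

lemma map_cube_edges: "map cube_edges [0..23] = [3, 6, 9, 0, 12, 15, 1, 17, 18, 2, 20, 13, 4, 11,
    21, 5, 23, 7, 8, 22, 10, 14, 19, 16]"
  using map_nth_upto[of "[3, 6, 9, 0, 12, 15, 1, 17, 18, 2, 20, 13, 4, 11,
    21, 5, 23, 7, 8, 22, 10, 14, 19, 16::int]"]
  unfolding cube_edges_def by simp

lemma map_dodecahedron_edges: "map dodecahedron_edges [0..59] =
    [3, 6, 9, 0, 12, 15, 1, 18, 21, 2, 24, 27, 4, 29, 30, 5, 33, 19, 7, 17,
     36, 8, 39, 25, 10, 23, 42, 11, 45, 13, 14, 48, 34, 16, 32, 51, 20, 53, 40, 22, 38, 54, 26, 56,
     46, 28, 44, 49, 31, 47, 57, 35, 59, 37, 41, 58, 43, 50, 55, 52]"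
  using map_nth_upto[of "[3, 6, 9, 0, 12, 15, 1, 18, 21, 2, 24, 27, 4, 29, 30, 5, 33, 19, 7, 17,
     36, 8, 39, 25, 10, 23, 42, 11, 45, 13, 14, 48, 34, 16, 32, 51, 20, 53, 40, 22, 38, 54, 26, 56,
     46, 28, 44, 49, 31, 47, 57, 35, 59, 37, 41, 58, 43, 50, 55, 52::int]"]
  unfolding dodecahedron_edges_def by simp

lemmas tetrahedron_values =
  map_tetrahedron_edges[unfolded upto_11 list.map list.inject, simplified]
lemmas cube_values = map_cube_edges[unfolded upto_23 list.map list.inject, simplified]
lemmas dodecahedron_values =
  map_dodecahedron_edges[unfolded upto_59 list.map list.inject, simplified]

lemma all_by_list:
  assumes "list_all P [0..m::int]" "x \<in> {0..<m + 1}"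
  shows "P x"
  using assms by (auto simp: list_all_iff)

lemma regular_tetrahedron: "regular_sphere_map 3 3 {0..<12} next_third tetrahedron_edges"
proof -
  let ?b = tetrahedron_edges
  have 1: "list_all (\<lambda>x. ?b x \<in> {0..<12} \<and> ?b x \<noteq> x \<and> ?b (?b x) = x \<and>
      (x mod 3 = 0 \<longrightarrow> 0 < x \<longrightarrow> ?b x < x)) [0..11]"
    by (simp add: upto_11 tetrahedron_values)
  have 2: "list_all (\<lambda>x. next_third (?b (next_third (?b (next_third (?b x))))) = x \<and>
      next_third (?b x) \<noteq> x) [0..11]"
    \<comment> \<open>first the list, then \<open>next_third\<close>: unfolding it for a bound variable would nest its conditionals\<close>
    by (simp only: upto_11 list.pred_inject)
       (simp add: next_third_def tetrahedron_values)
  show ?thesis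
  proof (rule regular_cubic_map[where m = 1])
    fix x :: int assume "x \<in> {0..<12}"
    then have x: "x \<in> {0..<11 + 1}" by simp
    show "?b x \<in> {0..<12} \<and> ?b x \<noteq> x \<and> ?b (?b x) = x"
      and "x mod 3 = 0 \<Longrightarrow> 0 < x \<Longrightarrow> ?b x < x"
      using all_by_list[OF 1 x] by auto
    show "((next_third \<circ> ?b) ^^ 3) x = x \<and> ((next_third \<circ> ?b) ^^ 1) x \<noteq> x"
      using all_by_list[OF 2 x] by (simp add: numeral_eq_Suc)
  next
    fix j :: nat assume "j dvd 3" "j < 3"
    then show "j dvd 1" by (cases "j = 0 \<or> j = 1 \<or> j = 2") auto
  qed auto
qed

lemma regular_cube: "regular_sphere_map 3 4 {0..<24} next_third cube_edges"
proof -
  let ?b = cube_edges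
  have 1: "list_all (\<lambda>x. ?b x \<in> {0..<24} \<and> ?b x \<noteq> x \<and> ?b (?b x) = x \<and>
      (x mod 3 = 0 \<longrightarrow> 0 < x \<longrightarrow> ?b x < x)) [0..23]"
    by (simp add: upto_23 cube_values)
  have 2: "list_all (\<lambda>x. next_third (?b (next_third (?b (next_third (?b (next_third (?b x))))))) = x \<and>
      next_third (?b (next_third (?b x))) \<noteq> x) [0..23]"
    by (simp only: upto_23 list.pred_inject)
       (simp add: next_third_def cube_values)
  show ?thesis
  proof (rule regular_cubic_map[where m = 2])
    fix x :: int assume "x \<in> {0..<24}"
    then have x: "x \<in> {0..<23 + 1}" by simp
    show "?b x \<in> {0..<24} \<and> ?b x \<noteq> x \<and> ?b (?b x) = x"
      and "x mod 3 = 0 \<Longrightarrow> 0 < x \<Longrightarrow> ?b x < x"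
      using all_by_list[OF 1 x] by auto
    show "((next_third \<circ> ?b) ^^ 4) x = x \<and> ((next_third \<circ> ?b) ^^ 2) x \<noteq> x"
      using all_by_list[OF 2 x] by (simp add: numeral_eq_Suc)
  next
    fix j :: nat assume "j dvd 4" "j < 4"
    then show "j dvd 2" by (cases "j = 0 \<or> j = 1 \<or> j = 2 \<or> j = 3") auto
  qed auto
qed

lemma regular_dodecahedron: "regular_sphere_map 3 5 {0..<60} next_third dodecahedron_edges"
proof -
  let ?b = dodecahedron_edges
  have 1: "list_all (\<lambda>x. ?b x \<in> {0..<60} \<and> ?b x \<noteq> x \<and> ?b (?b x) = x \<and>
      (x mod 3 = 0 \<longrightarrow> 0 < x \<longrightarrow> ?b x < x)) [0..59]"
    by (simp add: upto_59 dodecahedron_values)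
  have 2: "list_all (\<lambda>x. next_third (?b (next_third (?b (next_third (?b (next_third (?b
      (next_third (?b x))))))))) = x \<and> next_third (?b x) \<noteq> x) [0..59]"
    by (simp only: upto_59 list.pred_inject)
       (simp add: next_third_def dodecahedron_values)
  show ?thesis
  proof (rule regular_cubic_map[where m = 1])
    fix x :: int assume "x \<in> {0..<60}"
    then have x: "x \<in> {0..<59 + 1}" by simp
    show "?b x \<in> {0..<60} \<and> ?b x \<noteq> x \<and> ?b (?b x) = x"
      and "x mod 3 = 0 \<Longrightarrow> 0 < x \<Longrightarrow> ?b x < x"
      using all_by_list[OF 1 x] by auto
    show "((next_third \<circ> ?b) ^^ 5) x = x \<and> ((next_third \<circ> ?b) ^^ 1) x \<noteq> x"
      using all_by_list[OF 2 x] by (simp add: numeral_eq_Suc)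
  next
    fix j :: nat assume "j dvd 5" "j < 5"
    then show "j dvd 1" by (cases "j = 0 \<or> j = 1 \<or> j = 2 \<or> j = 3 \<or> j = 4") auto
  qed auto
qed

text \<open>The condition is equivalent to \<open>(k - 2) (l - 2) < 4\<close>.\<close>

lemma spherical_types:
  fixes k l :: nat
  assumes k: "k \<ge> 2" and l: "l \<ge> 2" and pos: "1 / real k + 1 / real l > 1 / 2"
  shows "k = 2 \<or> l = 2 \<or> (k, l) \<in> {(3, 3), (3, 4), (4, 3), (3, 5), (5, 3)}"
proof (rule ccontr)
  assume neg: "\<not> ?thesis"
  then have ge: "k \<ge> 3" "l \<ge> 3" using k l by auto
  have "real k * real l < 2 * (real k + real l)"
    using pos ge by (simp add: field_simps)
  then have "real (k * l) < real (2 * (k + l))" by simp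
  then have lt: "k * l < 2 * (k + l)" using of_nat_less_iff by blast
  have "k < 6"
  proof (rule ccontr)
    assume "\<not> k < 6"
    then obtain k' l' where "k = k' + 6" "l = l' + 3"
      using ge by (metis add.commute le_Suc_ex not_less)
    then show False using lt by (simp add: algebra_simps)
  qed
  moreover have "l < 6"
  proof (rule ccontr)
    assume "\<not> l < 6"
    then obtain k' l' where "k = k' + 3" "l = l' + 6"
      using ge by (metis add.commute le_Suc_ex not_less)
    then show False using lt by (simp add: algebra_simps)
  qed
  ultimately have "k \<in> {3, 4, 5}" "l \<in> {3, 4, 5}" using ge by auto
  then show False using lt neg by auto
qed

theorem regular_sphere_map_exists:
  fixes k l :: nat
  assumes k: "k \<ge> 2" and l: "l \<ge> 2" and pos: "1 / real k + 1 / real l > 1 / 2"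
  obtains X :: "int set" and t b where "regular_sphere_map k l X t b"
  using spherical_types[OF assms] that regular_dihedral_map[OF k] regular_dihedral_map[OF l]
    regular_tetrahedron regular_cube regular_dodecahedron regular_sphere_map_dual
  by (elim disjE) (blast | auto)+

section \<open>Spheres with two distinguished cells\<close>

text \<open>The formula \<open>total\<close> means \<open>x1 + x2 = N c\<close>, and then \<open>euler\<close> leaves no room for \<open>h y\<close> to exceed 1.
  Here \<open>x\<^sub>i\<close> stands for \<open>u\<^sub>i / k\<^sub>i\<close>, \<open>y\<^sub>i\<close> for
  \<open>u\<^sub>i / lcm u\<^sub>i k\<^sub>i\<close>, and \<open>c\<close> for \<open>1 / k + 1 / l - 1 / 2\<close>.\<close>

lemma two_cells_arith:
  fixes c x1 x2 y1 y2 :: real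
  assumes h: "h > 0" and n: "n > 0" and cover: "h * N = n * M" and Mc: "M * c = 2"
    and total: "N * c + (1 - x1) + (1 - x2) = 2"
    and euler: "h * (N * c + (y1 - x1) + (y2 - x2)) \<le> 2"
    and y: "h * y1 \<ge> 1" "h * y2 \<ge> 1"
    and bound: "x1 \<le> n * y1" "x2 \<le> n * y2"
  shows "x1 = x2" "h * y1 = 1" "h * y2 = 1"
proof -
  have Nc: "N * c = x1 + x2" using total by simp
  have "h * (y1 + y2) \<le> 2" using euler unfolding Nc by (simp add: algebra_simps)
  then show y1: "h * y1 = 1" and y2: "h * y2 = 1" using y by (simp_all add: algebra_simps)
  have "h * (x1 + x2) = 2 * n"
    using cover Mc Nc by (metis mult.assoc mult.commute)
  moreover have "h * x1 \<le> n" "h * x2 \<le> n"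
    using mult_left_mono[OF bound(1), of h] mult_left_mono[OF bound(2), of h] h y1 y2
    by (simp_all add: mult.left_commute[of h n])
  ultimately have "h * x1 = h * x2" unfolding distrib_left by linarith
  then show "x1 = x2" using h by simp
qed

lemma sum_with_one_cell:
  fixes F :: "nat \<Rightarrow> real"
  assumes "finite D" "B \<subseteq> D" "card B = u" "\<And>d. d \<in> B \<Longrightarrow> f d = u" "\<And>d. d \<in> D - B \<Longrightarrow> f d = k"
  shows "(\<Sum>d\<in>D. F (f d)) = real (card D) * F k + real u * (F u - F k)"
proof -
  have "finite B" using assms finite_subset by blast
  have "(\<Sum>d\<in>D. F (f d)) = (\<Sum>d\<in>D - B. F (f d)) + (\<Sum>d\<in>B. F (f d))"
    using assms by (simp add: sum.subset_diff)
  also have "(\<Sum>d\<in>D - B. F (f d)) = (\<Sum>d\<in>D - B. F k)" using assms by (intro sum.cong) auto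
  also have "(\<Sum>d\<in>B. F (f d)) = (\<Sum>d\<in>B. F u)" using assms by (intro sum.cong) auto
  also have "(\<Sum>d\<in>D - B. F k) = (real (card D) - real u) * F k"
    using assms \<open>finite B\<close> card_mono[OF assms(1,2)] by (simp add: card_Diff_subset of_nat_diff)
  finally show ?thesis using assms(3) by (simp add: algebra_simps)
qed

lemma sum_with_two_cells:
  fixes F :: "nat \<Rightarrow> real"
  assumes D: "finite D" "B \<subseteq> D" "C \<subseteq> D" "B \<inter> C = {}" "card B = u" "card C = v"
    and f: "\<And>d. d \<in> B \<Longrightarrow> f d = u" "\<And>d. d \<in> C \<Longrightarrow> f d = v" "\<And>d. d \<in> D - (B \<union> C) \<Longrightarrow> f d = k"
  shows "(\<Sum>d\<in>D. F (f d)) = real (card D) * F k + real u * (F u - F k) + real v * (F v - F k)"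
proof -
  have "finite C" using D finite_subset by blast
  have "(\<Sum>d\<in>D. F (f d)) = (\<Sum>d\<in>D - C. F (f d)) + (\<Sum>d\<in>C. F (f d))"
    by (rule sum.subset_diff[OF D(3,1)])
  also have "(\<Sum>d\<in>D - C. F (f d)) = real (card (D - C)) * F k + real u * (F u - F k)"
    by (rule sum_with_one_cell[where B = B]) (use D f in auto)
  also have "(\<Sum>d\<in>C. F (f d)) = (\<Sum>d\<in>C. F v)" using f by (intro sum.cong) auto
  also have "real (card (D - C)) = real (card D) - real v"
    using D \<open>finite C\<close> card_mono[OF D(1,3)] by (simp add: card_Diff_subset of_nat_diff)
  finally show ?thesis using D by (simp add: algebra_simps)
qed

text \<open>Since \<open>lcm u k * gcd u k = u * k\<close>, the hypothesis means \<open>h * gcd u k = k\<close>.\<close>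

lemma dvd_of_lcm_eq:
  fixes u k h :: nat
  assumes "lcm u k = h * u" "u > 0"
  shows "h dvd k" and "h = 1 \<Longrightarrow> k dvd u"
proof -
  have "(h * gcd u k) * u = k * u"
    using assms prod_gcd_lcm_nat[of u k] by (metis mult.assoc mult.commute)
  then show "h dvd k" using assms(2) by (metis dvd_triv_left mult_right_cancel not_gr0)
  show "k dvd u" if "h = 1" using assms that by (metis dvd_lcm2 mult_1)
qed

lemma lcm_quotient_bounds:
  fixes u k h n :: nat
  assumes "u > 0" "k > 0" "lcm u k \<le> h * u" "lcm u k \<le> n * k"
  shows "1 \<le> real h * (real u / real (lcm u k))"
    and "real u / real k \<le> real n * (real u / real (lcm u k))"
    and "real h * (real u / real (lcm u k)) = 1 \<Longrightarrow> lcm u k = h * u"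
proof -
  have L: "real (lcm u k) > 0" using assms(1,2) by (simp add: lcm_pos_nat)
  have 1: "real (lcm u k) \<le> real h * real u" and 2: "real (lcm u k) \<le> real n * real k"
    using assms(3,4) by (metis of_nat_le_iff of_nat_mult)+
  show "1 \<le> real h * (real u / real (lcm u k))"
    using 1 L by (simp add: pos_le_divide_eq)
  show "real u / real k \<le> real n * (real u / real (lcm u k))"
    using mult_left_mono[OF 2, of "real u"] L assms(2) by (simp add: field_simps)
  show "lcm u k = h * u" if "real h * (real u / real (lcm u k)) = 1"
  proof -
    have "real (lcm u k) = real (h * u)" using that L by (simp add: field_simps)
    then show ?thesis using of_nat_eq_iff by blast
  qed
qed

context combinatorial_map
begin

text \<open>The assumption \<open>total\<close> describes the two distinguished cells uniformly, whether they are
  vertices or faces: sums over all darts of functions of the degree and of its regular value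
  are those of a map without exceptions, corrected by \<open>u\<^sub>i\<close> summands for each of the two cells.
  It is applied to \<open>1 / i\<close>, which counts the cells of the map itself, and to \<open>1 / lcm i j\<close>, which
  counts those of the common covering.\<close>

lemma two_cells:
  fixes k l k1 k2 u1 u2 :: nat
  assumes conn: connected_map and ne: "D \<noteq> {}"
    and kl: "k \<ge> 2" "l \<ge> 2"
    and cells: "u1 > 0" "u2 > 0" "k1 > 0" "k2 > 0"
    and genus: "real (ncycles D s) + real (ncycles D (s \<circ> a)) = real (card D) / 2 + 2"
    and total: "\<And>F :: nat \<Rightarrow> nat \<Rightarrow> real.
      (\<Sum>d\<in>D. F (cycle_length D s d) k + F (cycle_length D (s \<circ> a) d) l) =
      real (card D) * (F k k + F l l) +
        real u1 * (F u1 k1 - F k1 k1) + real u2 * (F u2 k2 - F k2 k2)"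
    and occurs: "\<exists>d\<in>D. cycle_length D s d = u1 \<and> k1 = k \<or> cycle_length D (s \<circ> a) d = u1 \<and> k1 = l"
      "\<exists>d\<in>D. cycle_length D s d = u2 \<and> k2 = k \<or> cycle_length D (s \<circ> a) d = u2 \<and> k2 = l"
  obtains h where "h > 0" "real u1 / real k1 = real u2 / real k2"
    "lcm u1 k1 = h * u1" "lcm u2 k2 = h * u2" "1 / real k + 1 / real l > 1 / 2"
proof -
  define c where "c = 1 / real k + 1 / real l - 1 / 2"
  define N where "N = real (card D)"
  have Npos: "N > 0" using ne finite_darts by (simp add: N_def card_gt_0_iff)
  have "(\<Sum>d\<in>D. 1 / real (cycle_length D s d) + 1 / real (cycle_length D (s \<circ> a) d)) = N / 2 + 2"
    using genus by (simp add: ncycles_eq_sum[OF finite_darts] sum.distrib N_def)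
  \<comment> \<open>Euler's formula for the map itself\<close>
  then have chi: "N * c + (1 - real u1 / real k1) + (1 - real u2 / real k2) = 2"
    using total[of "\<lambda>i j. 1 / real i"] cells unfolding c_def N_def by (simp add: algebra_simps)
  then have "N * c = real u1 / real k1 + real u2 / real k2" by simp
  also have "\<dots> > 0" using cells by (simp add: add_pos_pos)
  finally have "c > 0" using Npos by (simp add: zero_less_mult_iff)
  then have spherical: "1 / real k + 1 / real l > 1 / 2" by (simp add: c_def)
  obtain X :: "int set" and t b where X: "regular_sphere_map k l X t b"
    using regular_sphere_map_exists[OF kl spherical] .
  obtain h n :: nat where hn: "h > 0" "n > 0" "h * card D = n * card X"
    "real h * (\<Sum>d\<in>D. 1 / real (lcm (cycle_length D s d) k) +
      1 / real (lcm (cycle_length D (s \<circ> a) d) l) - 1 / 2) \<le> 2"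
    "\<And>d. d \<in> D \<Longrightarrow> lcm (cycle_length D s d) k \<le> h * cycle_length D s d"
    "\<And>d. d \<in> D \<Longrightarrow> lcm (cycle_length D s d) k \<le> n * k"
    "\<And>d. d \<in> D \<Longrightarrow> lcm (cycle_length D (s \<circ> a) d) l \<le> h * cycle_length D (s \<circ> a) d"
    "\<And>d. d \<in> D \<Longrightarrow> lcm (cycle_length D (s \<circ> a) d) l \<le> n * l"
    using common_cover_with_regular[OF conn ne X] by blast
  have bounds1: "lcm u1 k1 \<le> h * u1" "lcm u1 k1 \<le> n * k1"
    using occurs(1) hn(5-8) by blast+
  have bounds2: "lcm u2 k2 \<le> h * u2" "lcm u2 k2 \<le> n * k2"
    using occurs(2) hn(5-8) by blast+
  note q1 = lcm_quotient_bounds[OF cells(1,3) bounds1]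
  note q2 = lcm_quotient_bounds[OF cells(2,4) bounds2]
  \<comment> \<open>the Euler characteristic of the common covering\<close>
  have euler: "real h * (N * c + (real u1 / real (lcm u1 k1) - real u1 / real k1) +
      (real u2 / real (lcm u2 k2) - real u2 / real k2)) \<le> 2"
  proof -
    have "(\<Sum>d\<in>D. 1 / real (lcm (cycle_length D s d) k) +
        1 / real (lcm (cycle_length D (s \<circ> a) d) l) - 1 / 2) =
        (\<Sum>d\<in>D. 1 / real (lcm (cycle_length D s d) k) +
        1 / real (lcm (cycle_length D (s \<circ> a) d) l)) - N / 2"
      by (simp add: sum_subtractf N_def)
    also have "\<dots> = N * c + (real u1 / real (lcm u1 k1) - real u1 / real k1) +
        (real u2 / real (lcm u2 k2) - real u2 / real k2)"
      using total[of "\<lambda>i j. 1 / real (lcm i j)"] unfolding c_def N_def by (simp add: algebra_simps)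
    finally show ?thesis using hn(4) by simp
  qed
  have cover: "real h * N = real n * real (card X)"
    using hn(3) unfolding N_def by (metis of_nat_mult)
  have Xc: "real (card X) * c = 2" using X by (simp add: regular_sphere_map_def c_def)
  have h: "real h > 0" and n: "real n > 0" using hn by simp_all
  note arith = two_cells_arith[OF h n cover Xc chi euler q1(1) q2(1) q1(2) q2(2)]
  show ?thesis
    using that[OF hn(1) arith(1) q1(3)[OF arith(2)] q2(3)[OF arith(3)] spherical] .
qed

lemma two_faces_equal:
  fixes k l u v :: nat
  assumes conn: connected_map and ne: "D \<noteq> {}" and kl: "k \<ge> 2" "l \<ge> 2"
    and genus: "real (ncycles D s) + real (ncycles D (s \<circ> a)) = real (card D) / 2 + 2"
    and vertices: "\<And>d. d \<in> D \<Longrightarrow> cycle_length D s d = k"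
    and BC: "B \<subseteq> D" "C \<subseteq> D" "B \<inter> C = {}" "card B = u" "card C = v" "u > 0" "v > 0"
    and faces: "\<And>d. d \<in> B \<Longrightarrow> cycle_length D (s \<circ> a) d = u"
      "\<And>d. d \<in> C \<Longrightarrow> cycle_length D (s \<circ> a) d = v"
      "\<And>d. d \<in> D - (B \<union> C) \<Longrightarrow> cycle_length D (s \<circ> a) d = l"
  shows "u = v"
proof -
  have total: "(\<Sum>d\<in>D. F (cycle_length D s d) k + F (cycle_length D (s \<circ> a) d) l) =
      real (card D) * (F k k + F l l) + real u * (F u l - F l l) + real v * (F v l - F l l)"
    for F :: "nat \<Rightarrow> nat \<Rightarrow> real"
  proof -
    have "(\<Sum>d\<in>D. F (cycle_length D (s \<circ> a) d) l) =
        real (card D) * F l l + real u * (F u l - F l l) + real v * (F v l - F l l)"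
      by (rule sum_with_two_cells[OF finite_darts BC(1-5), where F = "\<lambda>i. F i l"])
         (use faces in auto)
    moreover have "(\<Sum>d\<in>D. F (cycle_length D s d) k) = real (card D) * F k k"
      using vertices by simp
    ultimately show ?thesis by (simp add: sum.distrib algebra_simps)
  qed
  have "B \<noteq> {}" "C \<noteq> {}" using BC by auto
  then have occurs: "\<exists>d\<in>D. cycle_length D s d = u \<and> l = k \<or> cycle_length D (s \<circ> a) d = u \<and> l = l"
    "\<exists>d\<in>D. cycle_length D s d = v \<and> l = k \<or> cycle_length D (s \<circ> a) d = v \<and> l = l"
    using faces BC by blast+
  have l0: "l > 0" using kl by simp
  obtain h where "real u / real l = real v / real l"
    using two_cells[OF conn ne kl BC(6,7) l0 l0 genus total occurs] by blast
  then show ?thesis using l0 by simp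
qed

text \<open>The type \<open>(3, 3)\<close> remains because a divisor \<open>h > 1\<close> is possible there.  If \<open>k = 2\<close>, the
  exceptional degree \<open>u\<close> is even since the number of darts is even, and dually for \<open>l = 2\<close>.\<close>

lemma vertex_and_face:
  fixes k l u v :: nat
  assumes conn: connected_map and ne: "D \<noteq> {}" and kl: "k \<ge> 2" "l \<ge> 2"
    and genus: "real (ncycles D s) + real (ncycles D (s \<circ> a)) = real (card D) / 2 + 2"
    and B: "B \<subseteq> D" "card B = u" "u > 0"
    and vertices: "\<And>d. d \<in> B \<Longrightarrow> cycle_length D s d = u"
      "\<And>d. d \<in> D - B \<Longrightarrow> cycle_length D s d = k"
    and C: "C \<subseteq> D" "card C = v" "v > 0"
    and faces: "\<And>d. d \<in> C \<Longrightarrow> cycle_length D (s \<circ> a) d = v"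
      "\<And>d. d \<in> D - C \<Longrightarrow> cycle_length D (s \<circ> a) d = l"
  shows "real u / real k = real v / real l"
    and "k dvd u \<and> l dvd v \<or> k = 3 \<and> l = 3"
proof -
  have sumB: "(\<Sum>d\<in>D. F (cycle_length D s d)) = real (card D) * F k + real u * (F u - F k)"
    for F :: "nat \<Rightarrow> real"
    by (rule sum_with_one_cell[OF finite_darts B(1,2)]) (use vertices in auto)
  have sumC: "(\<Sum>d\<in>D. F (cycle_length D (s \<circ> a) d)) = real (card D) * F l + real v * (F v - F l)"
    for F :: "nat \<Rightarrow> real"
    by (rule sum_with_one_cell[OF finite_darts C(1,2)]) (use faces in auto)
  have total: "(\<Sum>d\<in>D. F (cycle_length D s d) k + F (cycle_length D (s \<circ> a) d) l) =
      real (card D) * (F k k + F l l) + real u * (F u k - F k k) + real v * (F v l - F l l)"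
    for F :: "nat \<Rightarrow> nat \<Rightarrow> real"
    using sumB[of "\<lambda>i. F i k"] sumC[of "\<lambda>i. F i l"] by (simp add: sum.distrib algebra_simps)
  have "B \<noteq> {}" "C \<noteq> {}" using B C by auto
  then have occurs: "\<exists>d\<in>D. cycle_length D s d = u \<and> k = k \<or> cycle_length D (s \<circ> a) d = u \<and> k = l"
    "\<exists>d\<in>D. cycle_length D s d = v \<and> l = k \<or> cycle_length D (s \<circ> a) d = v \<and> l = l"
    using vertices faces B C by blast+
  have k0: "k > 0" and l0: "l > 0" using kl by simp_all
  obtain h where h: "h > 0" "real u / real k = real v / real l" "lcm u k = h * u" "lcm v l = h * v"
    and spherical: "1 / real k + 1 / real l > 1 / 2"
    using two_cells[OF conn ne kl B(3) C(3) k0 l0 genus total occurs] by blast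
  show "real u / real k = real v / real l" by (rule h(2))
  have h_dvd: "h dvd k" "h dvd l" and h1: "h = 1 \<Longrightarrow> k dvd u \<and> l dvd v"
    using dvd_of_lcm_eq[OF h(3) B(3)] dvd_of_lcm_eq[OF h(4) C(3)] by blast+
  have even_D: "even (card D)" using half_darts_exist by (metis dvd_triv_left)
  show "k dvd u \<and> l dvd v \<or> k = 3 \<and> l = 3"
  proof (cases "h = 1")
    case False
    consider "k = 2" | "l = 2" | "(k, l) \<in> {(3, 3), (3, 4), (4, 3), (3, 5), (5, 3)}"
      using spherical_types[OF kl spherical] by blast
    then show ?thesis
    proof cases
      case 1
      have "real (2 * ncycles D s + u) = real (card D + 2)"
        using sumB[of "\<lambda>i. 1 / real i"] ncycles_eq_sum[OF finite_darts, of s] 1 B(3)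
        by (simp add: algebra_simps)
      then have "2 * ncycles D s + u = card D + 2" using of_nat_eq_iff by blast
      then have "even u" using even_D by presburger
      then have "lcm u k = u" using 1 by (simp add: lcm_proj1_if_dvd)
      then show ?thesis using h(3) B(3) False by simp
    next
      case 2
      have "real (2 * ncycles D (s \<circ> a) + v) = real (card D + 2)"
        using sumC[of "\<lambda>i. 1 / real i"] ncycles_eq_sum[OF finite_darts, of "s \<circ> a"] 2 C(3)
        by (simp add: algebra_simps)
      then have "2 * ncycles D (s \<circ> a) + v = card D + 2" using of_nat_eq_iff by blast
      then have "even v" using even_D by presburger
      then have "lcm v l = v" using 2 by (simp add: lcm_proj1_if_dvd)
      then show ?thesis using h(4) C(3) False by simp
    next
      case 3
      have "(k, l) = (3, 3) \<or> gcd k l = 1" using 3 by (auto simp: gcd_non_0_nat)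
      moreover have "h dvd gcd k l" using h_dvd by simp
      ultimately have "(k, l) = (3, 3) \<or> h dvd 1" by metis
      then show ?thesis using False by simp
    qed
  qed (use h1 in blast)
qed

end

section \<open>Separation by curves on the sphere\<close>

lemma stereographic_projection:
  fixes p :: "real ^ 3"
  assumes "p \<in> sphere 0 1"
  obtains h k where "homeomorphism (sphere 0 1 - {p}) (UNIV :: complex set) h k"
proof -
  have "(sphere (0 :: real ^ 3) 1 - {p}) homeomorphic (UNIV :: complex set)"
    by (rule homeomorphic_punctured_sphere_affine) (use assms in auto)
  then show ?thesis using that by (auto simp: homeomorphic_def)
qed

text \<open>A disc stays connected when a point is removed, but its image in the parameter interval would
  be cut into two pieces by the parameter of a suitable point.\<close>

lemma open_subset_arc_image_empty:
  fixes g :: "real \<Rightarrow> complex"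
  assumes g: "arc g" and V: "open V" "V \<subseteq> path_image g"
  shows "V = {}"
proof (rule ccontr)
  assume "V \<noteq> {}"
  then obtain z e where e: "e > 0" "ball z e \<subseteq> V"
    using V(1) by (metis all_not_in_conv openE)
  obtain f where f: "homeomorphism {0..1} (path_image g) g f"
    using homeomorphism_arc[OF g] by blast
  let ?B = "ball z e"
  have B: "?B \<subseteq> path_image g" using e V by blast
  have cont: "continuous_on ?B f"
    using f B continuous_on_subset by (metis homeomorphism_def)
  have inj: "inj_on f ?B"
    by (rule inj_on_inverseI[where g = g]) (use f B in \<open>auto simp: homeomorphism_def\<close>)
  define z1 where "z1 = z + of_real (e / 2)"
  define z2 where "z2 = z - of_real (e / 2)"
  have in_B: "z \<in> ?B" "z1 \<in> ?B" "z2 \<in> ?B"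
    using e(1) by (auto simp: z1_def z2_def dist_norm)
  have ne: "z \<noteq> z1" "z \<noteq> z2" "z1 \<noteq> z2"
    using e(1) by (auto simp: z1_def z2_def)
  \<comment> \<open>no point of the disc can have a parameter between those of two others\<close>
  have no_middle: "\<not> (f u < f v \<and> f v < f w)" if "u \<in> ?B" "v \<in> ?B" "w \<in> ?B" for u v w
  proof
    assume lt: "f u < f v \<and> f v < f w"
    have "connected (?B - {v})"
      by (rule connected_open_delete) auto
    then have "connected (f ` (?B - {v}))"
      by (rule connected_continuous_image[rotated]) (use cont in \<open>auto intro: continuous_on_subset\<close>)
    moreover have "f u \<in> f ` (?B - {v})" "f w \<in> f ` (?B - {v})" using that lt by auto
    ultimately have "{f u..f w} \<subseteq> f ` (?B - {v})" by (rule connected_contains_Icc)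
    moreover have "f v \<in> {f u..f w}" using lt by simp
    ultimately have "f v \<in> f ` (?B - {v})" by (rule subsetD)
    then show False using inj that(2) by (auto simp: inj_on_def)
  qed
  have "f z \<noteq> f z1" "f z \<noteq> f z2" "f z1 \<noteq> f z2"
    using inj in_B ne by (auto simp: inj_on_def)
  then show False
    using no_middle[of z z1 z2] no_middle[of z z2 z1] no_middle[of z1 z z2] no_middle[of z1 z2 z]
      no_middle[of z2 z z1] no_middle[of z2 z1 z] in_B by linarith
qed

lemma stereographic_image_open:
  fixes p :: "real ^ 3"
  assumes h: "homeomorphism (sphere 0 1 - {p}) (UNIV :: complex set) h k"
    and U: "openin (top_of_set (sphere 0 1)) U"
  shows "open (h ` (U - {p}))"
proof -
  have "openin (top_of_set (sphere 0 1 - {p})) (U - {p})"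
  proof -
    obtain T where T: "open T" "U = sphere 0 1 \<inter> T" using U by (auto simp: openin_open)
    then have "U - {p} = (sphere 0 1 - {p}) \<inter> T" by blast
    then show ?thesis using T(1) by (auto simp: openin_open)
  qed
  then have "openin (top_of_set UNIV) (h ` (U - {p}))"
    by (rule homeomorphism_imp_open_map[OF h])
  then show ?thesis by simp
qed

lemma open_subset_arc_image_on_sphere:
  fixes g :: "real \<Rightarrow> real ^ 3"
  assumes g: "arc g" "path_image g \<subseteq> sphere 0 1" and p: "p \<in> sphere 0 1" "p \<notin> path_image g"
    and U: "openin (top_of_set (sphere 0 1)) U" "U \<subseteq> path_image g"
  shows "U = {}"
proof -
  obtain h k where h: "homeomorphism (sphere 0 1 - {p}) (UNIV :: complex set) h k"
    using stereographic_projection[OF p(1)] .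
  have img: "path_image g \<subseteq> sphere 0 1 - {p}" using g p by blast
  have "arc (h \<circ> g)"
    unfolding arc_def
  proof
    have "continuous_on (path_image g) h"
      using h img by (meson continuous_on_subset homeomorphism_def)
    then show "path (h \<circ> g)" using g(1) by (simp add: arc_imp_path path_continuous_image)
    have "inj_on h (path_image g)"
      by (rule inj_on_inverseI[where g = k]) (use h img in \<open>auto simp: homeomorphism_def\<close>)
    then show "inj_on (h \<circ> g) {0..1}"
      using g(1) by (intro comp_inj_on) (auto simp: arc_def path_image_def)
  qed
  moreover have "h ` (U - {p}) \<subseteq> path_image (h \<circ> g)"
    using U(2) by (auto simp: path_image_compose)
  ultimately have "h ` (U - {p}) = {}"
    using open_subset_arc_image_empty stereographic_image_open[OF h U(1)] by blast
  then show ?thesis using U(2) p(2) by auto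
qed

text \<open>The two sides are described by open subsets \<open>A\<close> and \<open>B\<close> of space, as needed to see that no
  connected set off the curve meets both.  Both sides come close to every point of the curve.  The
  point \<open>p\<close> is the centre of a stereographic projection; the side \<open>B\<close> contains it, which is why \<open>B\<close> is
  the complement of a compact set instead of an image under the inverse projection.\<close>

lemma Jordan_curve_on_sphere:
  fixes c :: "real \<Rightarrow> real ^ 3"
  assumes c: "simple_path c" "pathfinish c = pathstart c" "path_image c \<subseteq> sphere 0 1"
    and p: "p \<in> sphere 0 1" "p \<notin> path_image c"
  obtains A B where "open A" "open B" "sphere 0 1 - path_image c \<subseteq> A \<union> B"
    "A \<inter> B \<inter> (sphere 0 1 - path_image c) = {}"
    "\<And>U x. openin (top_of_set (sphere 0 1)) U \<Longrightarrow> x \<in> U \<Longrightarrow> x \<in> path_image c \<Longrightarrow>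
      U \<inter> A - path_image c \<noteq> {} \<and> U \<inter> B - path_image c \<noteq> {}"
proof -
  let ?S = "sphere (0 :: real ^ 3) 1" and ?C = "path_image c"
  obtain h k where h: "homeomorphism (?S - {p}) (UNIV :: complex set) h k"
    using stereographic_projection[OF p(1)] .
  have hk: "\<And>x. x \<in> ?S - {p} \<Longrightarrow> k (h x) = x" "\<And>z. h (k z) = z"
    using h unfolding homeomorphism_def by blast+
  have img: "?C \<subseteq> ?S - {p}" using c p by blast
  let ?C' = "path_image (h \<circ> c)"
  have C': "?C' = h ` ?C" by (rule path_image_compose)
  have "continuous_on ?C h" using h img by (meson continuous_on_subset homeomorphism_def)
  moreover have "inj_on h ?C"
    by (rule inj_on_inverseI[where g = k]) (use hk(1) img in blast)
  ultimately have "simple_path (h \<circ> c)" using c(1) simple_path_continuous_image by blast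
  moreover have "pathfinish (h \<circ> c) = pathstart (h \<circ> c)"
    using c(2) by (simp add: pathfinish_compose pathstart_compose)
  ultimately have J: "open (inside ?C')" "bounded (inside ?C')" "inside ?C' \<inter> outside ?C' = {}"
    "inside ?C' \<union> outside ?C' = - ?C'" "frontier (inside ?C') = ?C'" "frontier (outside ?C') = ?C'"
    using Jordan_inside_outside[of "h \<circ> c"] by blast+
  let ?I = "k ` inside ?C'"
  have "openin (top_of_set (?S - {p})) ?I"
    using homeomorphism_imp_open_map[OF homeomorphism_symD[OF h], of "inside ?C'"] J(1) by simp
  moreover have "openin (top_of_set ?S) (?S - {p})" by (simp add: openin_delete)
  ultimately have "openin (top_of_set ?S) ?I" using openin_trans by blast
  then obtain A where A: "open A" "?I = ?S \<inter> A" by (auto simp: openin_open)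
  have "inside ?C' \<union> ?C' = closure (inside ?C')"
    using J(5) by (metis closure_Un_frontier)
  then have "compact (inside ?C' \<union> ?C')" using J(2) by (metis compact_closure)
  then have "compact (k ` (inside ?C' \<union> ?C'))"
    by (rule compact_continuous_image[rotated])
       (use h in \<open>auto simp: homeomorphism_def intro: continuous_on_subset\<close>)
  then have clK: "closed (k ` (inside ?C' \<union> ?C'))" by (rule compact_imp_closed)
  have "k (h x) = x" if "x \<in> ?C" for x using that hk(1) img by blast
  then have kC: "k ` ?C' = ?C" unfolding C' image_image by simp
  let ?B = "- (k ` (inside ?C' \<union> ?C'))"
  have not_C: "k z \<notin> ?C" if "z \<notin> ?C'" for z
    using that hk(2) unfolding C' by (metis imageI)
  show ?thesis
  proof (rule that[OF A(1), of ?B])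
    show "open ?B" using clK by auto
    have B: "?B = - ?I \<inter> - ?C" using kC by (simp add: image_Un)
    show "?S - ?C \<subseteq> A \<union> ?B" unfolding B using A(2) by blast
    show "A \<inter> ?B \<inter> (?S - ?C) = {}" unfolding B using A(2) by blast
    fix U x assume U: "openin (top_of_set ?S) U" "x \<in> U" and x: "x \<in> ?C"
    have op: "open (h ` (U - {p}))" by (rule stereographic_image_open[OF h U(1)])
    have US: "U \<subseteq> ?S" using U(1) by (rule openin_imp_subset)
    have hx: "h x \<in> h ` (U - {p})" using U(2) x p by blast
    have hxC: "h x \<in> ?C'" using x unfolding C' by blast
    have in_U: "k z \<in> U" if z: "z \<in> h ` (U - {p})" for z
    proof -
      obtain u where u: "u \<in> U - {p}" "z = h u" using z by blast
      then have "k (h u) = u" using hk(1) US by blast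
      then show "k z \<in> U" using u by simp
    qed
    obtain z where z: "z \<in> inside ?C'" "z \<in> h ` (U - {p})"
    proof -
      have "h x \<in> closure (inside ?C')" using hxC J(5) by (auto simp: frontier_def)
      then show ?thesis using that op hx by (auto simp: closure_iff_nhds_not_empty)
    qed
    then have "k z \<in> U \<inter> A - ?C"
      using in_U[OF z(2)] A(2) not_C[of z] inside_no_overlap[of ?C'] by blast
    moreover obtain w where w: "w \<in> outside ?C'" "w \<in> h ` (U - {p})"
    proof -
      have "h x \<in> closure (outside ?C')" using hxC J(6) by (auto simp: frontier_def)
      then show ?thesis using that op hx by (auto simp: closure_iff_nhds_not_empty)
    qed
    have "w \<notin> ?C'" using w(1) outside_no_overlap[of ?C'] by blast
    moreover have "k w \<notin> ?I"
    proof
      assume "k w \<in> ?I"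
      then obtain w' where "w' \<in> inside ?C'" "k w = k w'" by blast
      moreover from this have "w = w'" using hk(2) by metis
      ultimately show False using w(1) J(3) by blast
    qed
    ultimately have "k w \<in> U \<inter> ?B - ?C" unfolding B using in_U[OF w(2)] not_C by blast
    then show "U \<inter> A - ?C \<noteq> {} \<and> U \<inter> ?B - ?C \<noteq> {}"
      using \<open>k z \<in> U \<inter> A - ?C\<close> by blast
  qed
qed

section \<open>A lower bound for the number of faces\<close>

text \<open>Finite sets of points in pairwise different components give lower bounds for the number of
  components before it is known to be finite.\<close>

definition separated_in :: "'a::topological_space set \<Rightarrow> 'a set \<Rightarrow> bool" where
  "separated_in X P \<longleftrightarrow> finite P \<and> P \<subseteq> X \<and> pairwise (\<lambda>x y. \<not> connected_component X x y) P"

text \<open>The edge \<open>e\<close> is drawn in the complement of \<open>K\<close>, with its ends on \<open>K\<close>.  The point \<open>p\<close> off the curves is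
  needed as the centre of a stereographic projection.\<close>

locale new_edge_on_sphere =
  fixes K :: "(real ^ 3) set" and e :: "real \<Rightarrow> real ^ 3" and p :: "real ^ 3"
  assumes K: "closed K" "K \<subseteq> sphere 0 1"
    and e: "simple_path e" "path_image e \<subseteq> sphere 0 1"
    and inner: "e ` {0<..<1} \<inter> K = {}"
    and ends: "pathstart e \<in> K" "pathfinish e \<in> K"
    and p: "p \<in> sphere 0 1" "p \<notin> K" "p \<notin> path_image e"
begin

abbreviation S :: "(real ^ 3) set" where "S \<equiv> sphere 0 1"

text \<open>The face of \<open>K\<close> in which the new edge is drawn; it is the only one that the edge can split.\<close>

definition U :: "(real ^ 3) set" where
  "U = connected_component_set (S - K) (e (1 / 2))"

lemma path_image_e: "path_image e = e ` {0<..<1} \<union> {pathstart e, pathfinish e}"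
proof -
  have "{0..1} = {0<..<1} \<union> {0, 1 :: real}" by auto
  then show ?thesis by (simp add: path_image_def pathstart_def pathfinish_def image_Un)
qed

lemma inner_in_U: "e ` {0<..<1} \<subseteq> U"
  unfolding U_def
proof (rule connected_component_maximal)
  show "e (1 / 2) \<in> e ` {0<..<1}" by auto
  show "connected (e ` {0<..<1})"
  proof (rule connected_continuous_image)
    show "continuous_on {0<..<1} e"
      using simple_path_imp_path[OF e(1)] unfolding path_def
      by (rule continuous_on_subset) auto
  qed simp
  show "e ` {0<..<1} \<subseteq> S - K" using e(2) inner path_image_e by blast
qed

lemma U_subset: "U \<subseteq> S - K"
  unfolding U_def by (rule connected_component_subset)

lemma open_U: "openin (top_of_set S) U"
proof -
  have "openin (top_of_set S) (S - K)"
    using K(1) by (simp add: Diff_eq openin_open_Int open_Compl)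
  moreover have "openin (top_of_set (S - K)) U"
    unfolding U_def
    by (intro openin_connected_component_locally_connected locally_open_subset[OF _ calculation])
       (rule locally_connected_sphere)
  ultimately show ?thesis using openin_trans by blast
qed

lemma in_U: "e (1 / 2) \<in> U"
  using inner_in_U by auto

text \<open>At most one point of \<open>P\<close> lies in \<open>U\<close>.  All others stay separated from each other and from \<open>U\<close>.\<close>

lemma outside_U:
  assumes "separated_in (S - K) P"
  shows "separated_in (S - (K \<union> path_image e)) (P - U)" "card P \<le> card (P - U) + 1"
    "finite P"
    "\<And>x y. x \<in> P - U \<Longrightarrow> y \<in> U \<Longrightarrow> \<not> connected_component (S - (K \<union> path_image e)) x y"
proof -
  let ?X = "S - (K \<union> path_image e)"
  have fin: "finite P" and sub: "P \<subseteq> S - K"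
    and pair: "\<And>x y. x \<in> P \<Longrightarrow> y \<in> P \<Longrightarrow> x \<noteq> y \<Longrightarrow> \<not> connected_component (S - K) x y"
    using assms by (auto simp: separated_in_def pairwise_def)
  have mono: "connected_component (S - K) x y" if "connected_component ?X x y" for x y
    by (rule connected_component_of_subset[OF that]) blast
  have "P - U \<subseteq> ?X"
    using sub inner_in_U ends path_image_e by blast
  then show "separated_in ?X (P - U)"
    unfolding separated_in_def pairwise_def using fin pair mono by blast
  show "finite P" by (rule fin)
  have same: "x = y" if "x \<in> P \<inter> U" "y \<in> P \<inter> U" for x y
  proof (rule ccontr)
    assume "x \<noteq> y"
    moreover have "connected_component (S - K) x y"
      using that connected_component_sym connected_component_trans unfolding U_def by blast
    ultimately show False using pair that by blast
  qed
  have "card (P \<inter> U) \<le> 1"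
    using same fin by (auto simp: card_le_Suc0_iff_eq)
  then show "card P \<le> card (P - U) + 1"
    using card_Un_le[of "P \<inter> U" "P - U"] by (simp add: Int_Diff_Un)
  show "\<not> connected_component ?X x y" if "x \<in> P - U" "y \<in> U" for x y
  proof
    assume "connected_component ?X x y"
    then have "connected_component (S - K) y x" using mono connected_component_sym by blast
    then have "x \<in> U" using that(2) connected_component_trans unfolding U_def by blast
    then show False using that by blast
  qed
qed

text \<open>No component is lost, because the arc cannot fill the face \<open>U\<close>.\<close>

lemma add_arc:
  assumes P: "separated_in (S - K) P" and ne: "pathstart e \<noteq> pathfinish e"
  obtains P' where "separated_in (S - (K \<union> path_image e)) P'" "card P \<le> card P'"
proof -
  note out = outside_U[OF P]
  have "arc e" using e(1) ne by (simp add: arc_simple_path)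
  then have "\<not> U \<subseteq> path_image e"
    using open_subset_arc_image_on_sphere[OF _ e(2) p(1,3) open_U] in_U by blast
  then obtain q where q: "q \<in> U" "q \<notin> path_image e" by blast
  let ?X = "S - (K \<union> path_image e)"
  have "q \<in> ?X" using q U_subset by blast
  moreover have "\<not> connected_component ?X x q \<and> \<not> connected_component ?X q x" if "x \<in> P - U" for x
    using out(4)[OF that q(1)] connected_component_sym by blast
  ultimately have "separated_in ?X (insert q (P - U))"
    using out(1) unfolding separated_in_def pairwise_insert by blast
  moreover have "card P \<le> card (insert q (P - U))"
    using out(2,3) q(1) by simp
  ultimately show ?thesis using that by blast
qed

text \<open>The edge and a path in \<open>K\<close> between its ends form a Jordan curve.  Near a point of the edge the
  face \<open>U\<close> reaches to both sides of this curve, and the edge cuts \<open>U\<close> into at least two pieces.\<close>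

lemma add_cycle_edge:
  assumes P: "separated_in (S - K) P" and cyc: "path_component K (pathfinish e) (pathstart e)"
  obtains P' where "separated_in (S - (K \<union> path_image e)) P'" "card P + 1 \<le> card P'"
proof -
  \<comment> \<open>a loop is itself a Jordan curve\<close>
  obtain c where c: "simple_path c" "pathfinish c = pathstart c" "path_image c \<subseteq> K \<union> path_image e"
    "path_image e \<subseteq> path_image c"
  proof (cases "pathfinish e = pathstart e")
    case True
    then show ?thesis using that[of e] e(1) by blast
  next
    case False
    let ?Q = "path_component_set K (pathfinish e)"
    have "path_connected ?Q" by (rule path_connected_path_component)
    moreover have "pathfinish e \<in> ?Q" "pathstart e \<in> ?Q"
      using cyc ends by (auto simp: path_component_refl)
    ultimately have "\<exists>g. arc g \<and> path_image g \<subseteq> ?Q \<and>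
        pathstart g = pathfinish e \<and> pathfinish g = pathstart e"
      using False unfolding path_connected_arcwise by metis
    then obtain g where g: "arc g" "path_image g \<subseteq> path_component_set K (pathfinish e)"
      "pathstart g = pathfinish e" "pathfinish g = pathstart e" by blast
    have gK: "path_image g \<subseteq> K" using g(2) path_component_subset by blast
    have "arc e" using e(1) False by (simp add: arc_simple_path)
    have "simple_path (e +++ g)"
      by (rule simple_path_join_loop) (use \<open>arc e\<close> g gK inner path_image_e in auto)
    then show ?thesis
      using that[of "e +++ g"] g gK by (simp add: path_image_join) blast
  qed
  have cS: "path_image c \<subseteq> S" using c(3) K(2) e(2) by blast
  have pc: "p \<notin> path_image c" using c(3) p by blast
  obtain A B where AB: "open A" "open B" "S - path_image c \<subseteq> A \<union> B"
    "A \<inter> B \<inter> (S - path_image c) = {}"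
    "\<And>V x. openin (top_of_set S) V \<Longrightarrow> x \<in> V \<Longrightarrow> x \<in> path_image c \<Longrightarrow>
      V \<inter> A - path_image c \<noteq> {} \<and> V \<inter> B - path_image c \<noteq> {}"
    using Jordan_curve_on_sphere[OF c(1,2) cS p(1) pc] by metis
  have "e (1 / 2) \<in> path_image c" using c(4) path_image_e by auto
  then obtain q1 q2 where q: "q1 \<in> U \<inter> A - path_image c" "q2 \<in> U \<inter> B - path_image c"
    using AB(5)[OF open_U in_U] by blast
  let ?X = "S - (K \<union> path_image e)"
  note out = outside_U[OF P]
  have X: "q1 \<in> ?X" "q2 \<in> ?X" using q U_subset c(4) by blast+
  have sep: "\<not> connected_component ?X q1 q2"
  proof
    assume "connected_component ?X q1 q2"
    then obtain T where T: "connected T" "T \<subseteq> ?X" "q1 \<in> T" "q2 \<in> T"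
      by (auto simp: connected_component_def)
    have "T \<subseteq> S - path_image c" using T(2) c(3) by blast
    then have "A \<inter> B \<inter> T = {}" "T \<subseteq> A \<union> B" using AB(3,4) by blast+
    then have "A \<inter> T = {} \<or> B \<inter> T = {}"
      using connectedD[OF T(1) AB(1,2)] by blast
    then show False using T q by blast
  qed
  have "q1 \<noteq> q2" using sep X by (metis connected_component_refl)
  have no: "\<not> connected_component ?X x q \<and> \<not> connected_component ?X q x"
    if "x \<in> P - U" "q \<in> {q1, q2}" for x q
    using out(4)[OF that(1), of q] that(2) q connected_component_sym by blast
  have "separated_in ?X (insert q1 (insert q2 (P - U)))"
    using out(1) no sep X connected_component_sym[of ?X q2 q1]
    unfolding separated_in_def pairwise_insert by blast
  moreover have "card P + 1 \<le> card (insert q1 (insert q2 (P - U)))"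
    using out(2,3) q \<open>q1 \<noteq> q2\<close> by simp
  ultimately show ?thesis using that by blast
qed

end

text \<open>This is \<open>F \<ge> 1 + E - V + c\<close>, where \<open>c\<close> is the number of connected components of the graph.  A new
  edge either lies on a cycle and adds a face, or joins two components.\<close>

lemma faces_lower_bound:
  fixes V :: "(real ^ 3) set" and T :: "(real \<Rightarrow> real ^ 3) set"
  assumes "finite T" and V: "finite V" "V \<subseteq> sphere 0 1"
    and T: "\<And>g. g \<in> T \<Longrightarrow> simple_path g \<and> path_image g \<subseteq> sphere 0 1 \<and> pathstart g \<in> V \<and>
      pathfinish g \<in> V \<and> g ` {0<..<1} \<inter> V = {}"
    and disj: "\<And>g h. g \<in> T \<Longrightarrow> h \<in> T \<Longrightarrow> g \<noteq> h \<Longrightarrow> g ` {0<..<1} \<inter> h ` {0<..<1} = {}"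
    and p: "p \<in> sphere 0 1" "p \<notin> V" "\<And>g. g \<in> T \<Longrightarrow> p \<notin> path_image g"
  shows "\<exists>P. separated_in (sphere 0 1 - (V \<union> (\<Union>g\<in>T. path_image g))) P \<and>
    1 + card T + ncomp V ((\<lambda>g. (pathstart g, pathfinish g)) ` T) \<le> card P + card V"
  using \<open>finite T\<close> T disj p(3)
proof (induction T rule: finite_induct)
  case empty
  have "separated_in (sphere 0 1 - V) {p}"
    using p(1,2) unfolding separated_in_def pairwise_def by blast
  then show ?case using ncomp_le_card[OF V(1), of "{}"] by (intro exI[of _ "{p}"]) simp
next
  case (insert e T)
  let ?ends = "\<lambda>g. (pathstart g, pathfinish g)"
  let ?K = "V \<union> (\<Union>g\<in>T. path_image g)"
  let ?E = "?ends ` T"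
  have E: "?E \<subseteq> V \<times> V" using insert.prems(1) by auto
  have "\<exists>P. separated_in (sphere 0 1 - ?K) P \<and> 1 + card T + ncomp V ?E \<le> card P + card V"
    by (rule insert.IH) (use insert.prems in auto)
  then obtain P where P: "separated_in (sphere 0 1 - ?K) P"
    "1 + card T + ncomp V ?E \<le> card P + card V" by blast
  have e: "simple_path e" "path_image e \<subseteq> sphere 0 1" "pathstart e \<in> V" "pathfinish e \<in> V"
    "e ` {0<..<1} \<inter> V = {}" using insert.prems(1) by auto
  have image: "path_image g \<subseteq> g ` {0<..<1} \<union> V" if "g \<in> insert e T" for g
  proof -
    have "{0..1} = {0<..<1} \<union> {0, 1 :: real}" by auto
    then show ?thesis
      using insert.prems(1)[OF that]
      by (simp add: path_image_def pathstart_def pathfinish_def image_Un)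
  qed
  interpret new: new_edge_on_sphere ?K e p
  proof
    have "compact (path_image g)" if "g \<in> T" for g
      using insert.prems(1) that by (simp add: compact_simple_path_image)
    then have "compact (\<Union>g\<in>T. path_image g)" using insert.hyps(1) by blast
    then show "closed ?K" using V(1) by (simp add: closed_Un compact_imp_closed finite_imp_closed)
    show "?K \<subseteq> sphere 0 1" using insert.prems(1) V(2) by blast
    show "e ` {0<..<1} \<inter> ?K = {}"
    proof -
      have "e ` {0<..<1} \<inter> path_image g = {}" if "g \<in> T" for g
      proof -
        have "g \<noteq> e" using that insert.hyps by auto
        then have "e ` {0<..<1} \<inter> g ` {0<..<1} = {}"
          using insert.prems(2)[of e g] that by blast
        then show ?thesis using image[of g] that e(5) by blast
      qed
      then show ?thesis using e(5) by blast
    qed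
    show "p \<notin> ?K" using p(2) insert.prems(3) by blast
    show "p \<notin> path_image e" using insert.prems(3) by blast
  qed (use e p(1) in auto)
  have Kins: "?K \<union> path_image e = V \<union> (\<Union>g\<in>insert e T. path_image g)" by blast
  have Eins: "?ends ` insert e T = insert (pathstart e, pathfinish e) ?E" by simp
  show ?case
  proof (cases "(pathstart e, pathfinish e) \<in> generated_equiv V ?E")
    case True
    then have "(pathstart e, pathfinish e) \<in> (?E \<union> ?E\<inverse>)\<^sup>*"
      by (simp add: generated_equiv_def)
    then have "path_component ?K (pathstart e) (pathfinish e)"
    proof (induction rule: rtrancl_induct)
      case base
      show ?case using e(3) by (simp add: path_component_refl)
    next
      case (step y z)
      obtain g where g: "g \<in> T" "(y, z) = ?ends g \<or> (z, y) = ?ends g"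
        using step.hyps(2) by blast
      have gK: "path_image g \<subseteq> ?K" using g(1) by blast
      have "path g" using insert.prems(1) g(1) by (simp add: simple_path_imp_path)
      then have "path_component ?K (pathstart g) (pathfinish g)"
        using gK by (auto simp: path_component_def)
      then have "path_component ?K y z"
        using g(2) path_component_sym by auto
      then show ?case using step.IH path_component_trans by blast
    qed
    then have "path_component ?K (pathfinish e) (pathstart e)" by (rule path_component_sym)
    then obtain P' where P': "separated_in (sphere 0 1 - (?K \<union> path_image e)) P'" "card P + 1 \<le> card P'"
      using new.add_cycle_edge[OF P(1)] by blast
    have "insert (pathstart e, pathfinish e) ?E \<subseteq> V \<times> V" using E e by auto
    have "?E \<subseteq> generated_equiv V (insert (pathstart e, pathfinish e) ?E)"
      using generated_equiv_incl[OF \<open>insert _ ?E \<subseteq> V \<times> V\<close>] by blast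
    then have "ncomp V (insert (pathstart e, pathfinish e) ?E) \<le> ncomp V ?E"
      by (rule ncomp_antimono[OF V(1)])
    then have "1 + card (insert e T) + ncomp V (?ends ` insert e T) \<le> card P' + card V"
      unfolding Eins using P(2) P'(2) insert.hyps by simp
    then show ?thesis using P'(1) unfolding Kins by blast
  next
    case False
    have "pathstart e \<noteq> pathfinish e"
      using False e(3) by (auto simp: generated_equiv_def)
    then obtain P' where P': "separated_in (sphere 0 1 - (?K \<union> path_image e)) P'" "card P \<le> card P'"
      using new.add_arc[OF P(1)] by blast
    have "ncomp V (insert (pathstart e, pathfinish e) ?E) + 1 \<le> ncomp V ?E"
      by (rule ncomp_insert_unrelated[OF V(1) E e(3,4) False])
    then have "1 + card (insert e T) + ncomp V (?ends ` insert e T) \<le> card P' + card V"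
      unfolding Eins using P(2) P'(2) insert.hyps by simp
    then show ?thesis using P'(1) unfolding Kins by blast
  qed
qed

lemma card_separated_le_components:
  assumes P: "separated_in X P" and fin: "finite (components X)"
  shows "card P \<le> card (components X)"
proof (rule card_inj_on_le[OF _ _ fin])
  show "inj_on (connected_component_set X) P"
  proof (rule inj_onI)
    fix x y assume xy: "x \<in> P" "y \<in> P" "connected_component_set X x = connected_component_set X y"
    have "y \<in> connected_component_set X y"
      using P xy by (auto simp: separated_in_def intro: connected_component_refl)
    then have "connected_component X x y" using xy(3) by blast
    then show "x = y" using P xy by (auto simp: separated_in_def pairwise_def)
  qed
  show "connected_component_set X ` P \<subseteq> components X"
    using P by (auto simp: separated_in_def components_def)
qed

section \<open>The combinatorial map of a plane graph\<close>

definition next_dart :: "plane_graph \<Rightarrow> dart \<Rightarrow> dart" where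
  "next_dart G g = (THE h. \<exists>f\<in>faces G. \<exists>i<length (bwalk G f). bwalk G f ! i = g \<and>
     h = bwalk G f ! (Suc i mod length (bwalk G f)))"

locale plane_graph_map =
  fixes G :: plane_graph
  assumes G: "graph G"
begin

abbreviation D :: "dart set" where "D \<equiv> darts G"

abbreviation rotate_dart :: "dart \<Rightarrow> dart" where
  "rotate_dart \<equiv> next_dart G \<circ> reversepath"

lemma embedding:
  shows "finite (verts G)" "verts G \<subseteq> sphere 0 1" "finite D" "D \<noteq> {}" "connected (support G)"
    and "g \<in> D \<Longrightarrow> simple_path g" "g \<in> D \<Longrightarrow> path_image g \<subseteq> sphere 0 1"
    and "g \<in> D \<Longrightarrow> pathstart g \<in> verts G" "g \<in> D \<Longrightarrow> pathfinish g \<in> verts G"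
    and "g \<in> D \<Longrightarrow> g ` {0<..<1} \<inter> verts G = {}" "g \<in> D \<Longrightarrow> reversepath g \<in> D"
    and "g \<in> D \<Longrightarrow> h \<in> D \<Longrightarrow> h \<noteq> g \<Longrightarrow> h \<noteq> reversepath g \<Longrightarrow>
      g ` {0<..<1} \<inter> h ` {0<..<1} = {}"
  using G by (simp_all add: graph_def embedded_graph_def)

lemma walks:
  shows "f \<in> faces G \<Longrightarrow> set (bwalk G f) \<subseteq> D" "f \<in> faces G \<Longrightarrow> distinct (bwalk G f)"
    and "f \<in> faces G \<Longrightarrow> bwalk G f \<noteq> []"
    and "f \<in> faces G \<Longrightarrow> i < length (bwalk G f) \<Longrightarrow>
      pathfinish (bwalk G f ! i) = pathstart (bwalk G f ! (Suc i mod length (bwalk G f)))"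
    and "g \<in> D \<Longrightarrow> h \<in> D \<Longrightarrow> pathstart g = pathstart h \<Longrightarrow> (g, h) \<in> (turn G)\<^sup>*"
  using G by (simp_all add: graph_def boundary_walks_def closed_walk_def)

lemma walk_exists:
  assumes "g \<in> D"
  obtains f i where "f \<in> faces G" "i < length (bwalk G f)" "bwalk G f ! i = g"
proof -
  have "\<exists>!f. f \<in> faces G \<and> g \<in> set (bwalk G f)"
    using G assms by (simp add: graph_def boundary_walks_def)
  then show ?thesis using that by (metis in_set_conv_nth)
qed

lemma walk_unique:
  assumes "f \<in> faces G" "f' \<in> faces G" "g \<in> set (bwalk G f)" "g \<in> set (bwalk G f')"
  shows "f = f'"
proof -
  have "g \<in> D" using assms walks(1) by blast
  then have "\<exists>!f. f \<in> faces G \<and> g \<in> set (bwalk G f)"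
    using G by (simp add: graph_def boundary_walks_def)
  then show ?thesis using assms by blast
qed

lemma next_dart_walk:
  assumes f: "f \<in> faces G" and i: "i < length (bwalk G f)"
  shows "next_dart G (bwalk G f ! i) = bwalk G f ! (Suc i mod length (bwalk G f))"
  unfolding next_dart_def
proof (rule the_equality)
  fix h assume "\<exists>f'\<in>faces G. \<exists>j<length (bwalk G f'). bwalk G f' ! j = bwalk G f ! i \<and>
     h = bwalk G f' ! (Suc j mod length (bwalk G f'))"
  then obtain f' j where f': "f' \<in> faces G" "j < length (bwalk G f')"
    "bwalk G f' ! j = bwalk G f ! i" "h = bwalk G f' ! (Suc j mod length (bwalk G f'))" by blast
  have "f' = f"
    using walk_unique[OF f'(1) f, of "bwalk G f ! i"] f'(2,3) i by (metis nth_mem)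
  moreover have "j = i"
    using f' i walks(2)[OF f] \<open>f' = f\<close> by (simp add: nth_eq_iff_index_eq)
  ultimately show "h = bwalk G f ! (Suc i mod length (bwalk G f))" using f'(4) by simp
qed (use assms in blast)

lemma funpow_next_dart:
  assumes f: "f \<in> faces G" and i: "i < length (bwalk G f)"
  shows "(next_dart G ^^ n) (bwalk G f ! i) = bwalk G f ! ((i + n) mod length (bwalk G f))"
proof (induction n)
  case (Suc n)
  have "(i + n) mod length (bwalk G f) < length (bwalk G f)" using i by (intro mod_less_divisor) auto
  then show ?case using Suc next_dart_walk[OF f] by (simp add: mod_Suc_eq)
qed (use i in simp)

lemma next_dart_closed:
  assumes "g \<in> D"
  shows "next_dart G g \<in> D"
proof -
  obtain f i where f: "f \<in> faces G" "i < length (bwalk G f)" "bwalk G f ! i = g"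
    using walk_exists[OF assms] .
  have "Suc i mod length (bwalk G f) < length (bwalk G f)" using f(2) by (intro mod_less_divisor) auto
  then show ?thesis using next_dart_walk[OF f(1,2)] f walks(1)[OF f(1)] nth_mem by auto
qed

lemma inj_next_dart: "inj_on (next_dart G) D"
proof (rule inj_onI)
  fix g h assume gh: "g \<in> D" "h \<in> D" and eq: "next_dart G g = next_dart G h"
  obtain f i where f: "f \<in> faces G" "i < length (bwalk G f)" "bwalk G f ! i = g"
    using walk_exists[OF gh(1)] .
  obtain f' j where f': "f' \<in> faces G" "j < length (bwalk G f')" "bwalk G f' ! j = h"
    using walk_exists[OF gh(2)] .
  let ?m = "length (bwalk G f)"
  have lt: "Suc i mod ?m < ?m" "Suc j mod length (bwalk G f') < length (bwalk G f')"
    using f(2) f'(2) by (intro mod_less_divisor; auto)+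
  have nx: "bwalk G f ! (Suc i mod ?m) = bwalk G f' ! (Suc j mod length (bwalk G f'))"
    using eq next_dart_walk[OF f(1,2)] next_dart_walk[OF f'(1,2)] f(3) f'(3) by simp
  then have "f = f'" using walk_unique[OF f(1) f'(1)] lt by (metis nth_mem)
  then have "Suc i mod ?m = Suc j mod ?m"
    using nx lt walks(2)[OF f(1)] by (simp add: nth_eq_iff_index_eq)
  then have "i = j" using f(2) f'(2) \<open>f = f'\<close> by (auto simp: mod_Suc split: if_splits)
  then show "g = h" using f(3) f'(3) \<open>f = f'\<close> by simp
qed

lemma reversepath_ne: "g \<in> D \<Longrightarrow> reversepath g \<noteq> g"
proof -
  assume "g \<in> D"
  then have "g (1 / 4) \<noteq> g (3 / 4)"
    using embedding(6) unfolding simple_path_def loop_free_def by fastforce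
  then show ?thesis by (auto simp: reversepath_def fun_eq_iff intro!: exI[of _ "1 / 4"])
qed

lemma perm_next_dart: "perm_on (next_dart G) D"
  using embedding(3) inj_next_dart next_dart_closed by (auto simp: perm_on_def)

lemma perm_rotate_dart: "perm_on rotate_dart D"
proof -
  have "inj_on rotate_dart D"
  proof (rule comp_inj_on)
    show "inj_on reversepath D" by (rule inj_on_inverseI[where g = reversepath]) simp
    show "inj_on (next_dart G) (reversepath ` D)"
      by (rule inj_on_subset[OF inj_next_dart]) (use embedding(11) in blast)
  qed
  then show ?thesis
    using embedding(3,11) next_dart_closed by (auto simp: perm_on_def)
qed

sublocale combinatorial_map D rotate_dart reversepath
  by standard (use perm_rotate_dart embedding(11) reversepath_ne in auto)

lemma face_perm: "rotate_dart \<circ> reversepath = next_dart G"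
  by (simp add: fun_eq_iff)

lemma face_cycle:
  assumes f: "f \<in> faces G" and g: "g \<in> set (bwalk G f)"
  shows "cycle_of_elem D (next_dart G) g = set (bwalk G f)"
proof -
  let ?w = "bwalk G f"
  obtain i where i: "i < length ?w" "?w ! i = g" using g by (auto simp: in_set_conv_nth)
  have "g \<in> D" using g walks(1)[OF f] by blast
  then have "cycle_of_elem D (next_dart G) g = range (\<lambda>n. ?w ! ((i + n) mod length ?w))"
    using cycle_of_elem_eq_orbit[OF perm_next_dart] funpow_next_dart[OF f i(1)] i(2) by simp
  also have "\<dots> = set ?w"
  proof
    show "range (\<lambda>n. ?w ! ((i + n) mod length ?w)) \<subseteq> set ?w"
      using i(1) by (auto intro!: nth_mem mod_less_divisor)
    show "set ?w \<subseteq> range (\<lambda>n. ?w ! ((i + n) mod length ?w))"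
    proof
      fix h assume "h \<in> set ?w"
      then obtain j where j: "j < length ?w" "?w ! j = h" by (auto simp: in_set_conv_nth)
      have "(i + (length ?w - i + j)) mod length ?w = j" using i(1) j(1) by simp
      then show "h \<in> range (\<lambda>n. ?w ! ((i + n) mod length ?w))"
        using j(2) by (intro image_eqI[where x = "length ?w - i + j"]) simp_all
    qed
  qed
  finally show ?thesis .
qed

lemma face_cycle_length:
  assumes "f \<in> faces G" "g \<in> set (bwalk G f)"
  shows "cycle_length D (rotate_dart \<circ> reversepath) g = face_degree G f"
  unfolding face_perm cycle_length_def face_cycle[OF assms] face_degree_def
  using walks(2)[OF assms(1)] by (rule distinct_card)

lemma turn_eq: "turn G = fun_edges D rotate_dart"
proof
  show "turn G \<subseteq> fun_edges D rotate_dart"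
  proof
    fix z assume "z \<in> turn G"
    then obtain f i where f: "f \<in> faces G" "i < length (bwalk G f)"
      "z = (reversepath (bwalk G f ! i), bwalk G f ! (Suc i mod length (bwalk G f)))"
      by (auto simp: turn_def)
    have "bwalk G f ! i \<in> D" using f walks(1) by (meson nth_mem subsetD)
    then have "reversepath (bwalk G f ! i) \<in> D" by (rule embedding(11))
    moreover have "z = (reversepath (bwalk G f ! i), rotate_dart (reversepath (bwalk G f ! i)))"
      using f next_dart_walk[OF f(1,2)] by simp
    ultimately show "z \<in> fun_edges D rotate_dart" by blast
  qed
  show "fun_edges D rotate_dart \<subseteq> turn G"
  proof
    fix z assume "z \<in> fun_edges D rotate_dart"
    then obtain d where d: "d \<in> D" "z = (d, next_dart G (reversepath d))" by auto
    obtain f i where f: "f \<in> faces G" "i < length (bwalk G f)" "bwalk G f ! i = reversepath d"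
      using walk_exists[OF embedding(11)[OF d(1)]] .
    then have "z = (reversepath (bwalk G f ! i), bwalk G f ! (Suc i mod length (bwalk G f)))"
      using d(2) next_dart_walk[OF f(1,2)] by simp
    then show "z \<in> turn G" using f unfolding turn_def by blast
  qed
qed

lemma pathstart_rotate_dart:
  assumes "d \<in> D"
  shows "pathstart (rotate_dart d) = pathstart d"
proof -
  obtain f i where f: "f \<in> faces G" "i < length (bwalk G f)" "bwalk G f ! i = reversepath d"
    using walk_exists[OF embedding(11)[OF assms]] .
  then show ?thesis using walks(4)[OF f(1,2)] next_dart_walk[OF f(1,2)] by simp
qed

text \<open>Rotation keeps the initial vertex, because consecutive darts of a boundary walk meet; that it
  reaches all darts at this vertex is what the condition on \<open>turn\<close> provides.\<close>

lemma vertex_cycle: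
  assumes d: "d \<in> D"
  shows "cycle_of_elem D rotate_dart d = {g \<in> D. pathstart g = pathstart d}"
proof
  have "pathstart ((rotate_dart ^^ n) d) = pathstart d" for n
  proof (induction n)
    case (Suc n)
    have "pathstart (rotate_dart ((rotate_dart ^^ n) d)) = pathstart ((rotate_dart ^^ n) d)"
      by (rule pathstart_rotate_dart[OF perm_on_funpow[OF perm_rotate_dart d]])
    moreover have "(rotate_dart ^^ Suc n) d = rotate_dart ((rotate_dart ^^ n) d)" by simp
    ultimately show ?case using Suc by (simp only:)
  qed simp
  then show "cycle_of_elem D rotate_dart d \<subseteq> {g \<in> D. pathstart g = pathstart d}"
    using perm_on_funpow[OF perm_rotate_dart d]
    unfolding cycle_of_elem_eq_orbit[OF perm_rotate_dart d] by blast
  have "(d, g) \<in> (fun_edges D rotate_dart \<union> (fun_edges D rotate_dart)\<inverse>)\<^sup>*"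
    if "g \<in> D" "pathstart g = pathstart d" for g
    using walks(5)[OF d that(1) that(2)[symmetric]] unfolding turn_eq
    by (intro in_rtrancl_UnI disjI1)
  then show "{g \<in> D. pathstart g = pathstart d} \<subseteq> cycle_of_elem D rotate_dart d"
    using d by (auto simp: generated_equiv_def)
qed

lemma vertex_cycle_length:
  assumes "d \<in> D"
  shows "cycle_length D rotate_dart d = vertex_degree G (pathstart d)"
  unfolding cycle_length_def vertex_cycle[OF assms] vertex_degree_def by (rule refl)

lemma path_image_inner:
  assumes "g \<in> D"
  shows "path_image g = g ` {0<..<1} \<union> {pathstart g, pathfinish g}"
proof -
  have "{0..1} = {0<..<1} \<union> {0, 1 :: real}" by auto
  then show ?thesis by (simp add: path_image_def pathstart_def pathfinish_def image_Un)
qed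

lemma closed_Union_path_images:
  assumes "Z \<subseteq> D"
  shows "closed (\<Union>g\<in>Z. path_image g)"
proof -
  have "finite Z" using assms embedding(3) by (rule finite_subset)
  moreover have "closed (path_image g)" if "g \<in> Z" for g
    using that assms embedding(6) by (meson closed_simple_path_image subsetD)
  ultimately show ?thesis by blast
qed

lemma support_split:
  assumes "support G \<subseteq> A \<union> B" "closed A" "closed B" "A \<inter> B = {}" "A \<inter> support G \<noteq> {}"
  shows "B \<inter> support G = {}"
proof -
  have "A \<inter> B \<inter> support G = {}" using assms(4) by simp
  from connected_closedD[OF embedding(5) this assms(1-3)] show ?thesis using assms(5) by simp
qed

text \<open>An isolated vertex would be separated from the edges, contrary to connectedness.\<close>

lemma dart_at_vertex:
  assumes x: "x \<in> verts G"
  obtains g where "g \<in> D" "pathstart g = x"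
proof -
  have False if none: "\<And>g. g \<in> D \<Longrightarrow> pathstart g \<noteq> x"
  proof -
    let ?B = "(verts G - {x}) \<union> (\<Union>g\<in>D. path_image g)"
    have "x \<notin> path_image g" if g: "g \<in> D" for g
    proof -
      have "pathfinish g \<noteq> x" using none[OF embedding(11)[OF g]] by simp
      then show ?thesis
        using none[OF g] embedding(10)[OF g] x unfolding path_image_inner[OF g] by blast
    qed
    then have disj: "{x} \<inter> ?B = {}" by blast
    have "closed ?B"
      using closed_Union_path_images[of D] embedding(1) by (simp add: closed_Un finite_imp_closed)
    moreover have "support G \<subseteq> {x} \<union> ?B" unfolding support_def by blast
    moreover have "{x} \<inter> support G \<noteq> {}" using x unfolding support_def by blast
    ultimately have "?B \<inter> support G = {}"
      using support_split[of "{x}" ?B] disj by simp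
    moreover obtain g where "g \<in> D" using embedding(4) by blast
    then have "pathstart g \<in> ?B \<inter> support G"
      unfolding support_def using pathstart_in_path_image by blast
    ultimately show False by blast
  qed
  then show ?thesis using that by blast
qed

text \<open>If the darts reachable from each other did not exhaust all darts, then the curves of the two
  kinds of darts would form disjoint closed sets: edges meet only at vertices, and the darts at a common
  vertex are connected by rotations.\<close>

lemma map_connected: connected_map
  unfolding connected_map_def
proof (intro allI impI)
  fix Z assume Z: "Z \<subseteq> D" "Z \<noteq> {}" "rotate_dart ` Z \<subseteq> Z" "reversepath ` Z \<subseteq> Z"
  have same_vertex: "h \<in> Z" if "g \<in> Z" "h \<in> D" "pathstart g = pathstart h" for g h
  proof -
    have "(g, h) \<in> (turn G)\<^sup>*" using walks(5) that Z(1) by blast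
    then show ?thesis
      by (induction rule: rtrancl_induct) (use that(1) Z(3) turn_eq in auto)
  qed
  have rev: "reversepath g \<in> Z \<longleftrightarrow> g \<in> Z" for g
    using Z(4) by (metis image_subset_iff reversepath_reversepath)
  let ?A = "\<Union>g\<in>Z. path_image g" and ?B = "\<Union>g\<in>D - Z. path_image g"
  have vertex_in: "\<exists>g'\<in>D. (g' \<in> Z \<longleftrightarrow> g \<in> Z) \<and> pathstart g' = x"
    if "g \<in> D" "x \<in> path_image g" "x \<in> verts G" for g x
  proof -
    have "x = pathstart g \<or> x = pathstart (reversepath g)"
      using that embedding(10)[OF that(1)] unfolding path_image_inner[OF that(1)] by auto
    then show ?thesis using that(1) rev embedding(11) by metis
  qed
  have disj: "?A \<inter> ?B = {}"
  proof (rule ccontr)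
    assume "?A \<inter> ?B \<noteq> {}"
    then obtain x g h where gh: "g \<in> Z" "h \<in> D - Z" "x \<in> path_image g" "x \<in> path_image h" by blast
    have gD: "g \<in> D" and hD: "h \<in> D" using gh Z(1) by blast+
    show False
    proof (cases "x \<in> verts G")
      case True
      then obtain g' h' where "g' \<in> D" "g' \<in> Z" "pathstart g' = x" "h' \<in> D" "h' \<notin> Z" "pathstart h' = x"
        using vertex_in[OF gD gh(3)] vertex_in[OF hD gh(4)] gh(1,2) by blast
      then show False using same_vertex[of g' h'] by simp
    next
      case False
      then have "x \<in> g ` {0<..<1} \<inter> h ` {0<..<1}"
        using gh(3,4) embedding(8,9)[OF gD] embedding(8,9)[OF hD]
        unfolding path_image_inner[OF gD] path_image_inner[OF hD] by auto
      then have "h = g \<or> h = reversepath g" using embedding(12)[OF gD hD] by blast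
      then show False using gh(1,2) rev by blast
    qed
  qed
  have cover: "support G \<subseteq> ?A \<union> ?B"
  proof
    fix x assume "x \<in> support G"
    then consider "x \<in> verts G" | g where "g \<in> D" "x \<in> path_image g"
      unfolding support_def by blast
    then obtain g where "g \<in> D" "x \<in> path_image g"
      by (metis dart_at_vertex pathstart_in_path_image)
    then show "x \<in> ?A \<union> ?B" by blast
  qed
  have meets: "?A \<inter> support G \<noteq> {}"
  proof -
    obtain g where "g \<in> Z" using Z(2) by blast
    then have "pathstart g \<in> ?A \<inter> support G"
      using Z(1) pathstart_in_path_image unfolding support_def by blast
    then show ?thesis by blast
  qed
  have cl: "closed ?A" "closed ?B" using closed_Union_path_images Z(1) by blast+
  have empty: "?B \<inter> support G = {}" by (rule support_split[OF cover cl disj meets])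
  show "Z = D"
  proof (rule ccontr)
    assume "Z \<noteq> D"
    then obtain h where h: "h \<in> D - Z" using Z(1) by blast
    then have "pathstart h \<in> ?B \<inter> support G"
      using pathstart_in_path_image unfolding support_def by blast
    then show False using empty by blast
  qed
qed

lemma card_vertices: "ncycles D rotate_dart = card (verts G)"
proof -
  have "D // generated_equiv D (fun_edges D rotate_dart) =
      (\<lambda>x. {g \<in> D. pathstart g = x}) ` verts G" (is "?L = ?F ` _")
  proof
    show "?L \<subseteq> ?F ` verts G"
    proof
      fix C assume "C \<in> ?L"
      then obtain d where d: "d \<in> D" "C = cycle_of_elem D rotate_dart d" by (auto elim: quotientE)
      then have "C = ?F (pathstart d)" using vertex_cycle by simp
      then show "C \<in> ?F ` verts G" using embedding(8)[OF d(1)] by blast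
    qed
    show "?F ` verts G \<subseteq> ?L"
    proof
      fix C assume "C \<in> ?F ` verts G"
      then obtain x where x: "x \<in> verts G" "C = ?F x" by blast
      obtain d where d: "d \<in> D" "pathstart d = x" using dart_at_vertex[OF x(1)] .
      then have "C = cycle_of_elem D rotate_dart d" using vertex_cycle x(2) by simp
      then show "C \<in> ?L" using d(1) by (simp add: quotientI)
    qed
  qed
  moreover have "inj_on ?F (verts G)"
  proof (rule inj_onI)
    fix x y assume xy: "x \<in> verts G" "y \<in> verts G" "?F x = ?F y"
    obtain d where "d \<in> D" "pathstart d = x" using dart_at_vertex[OF xy(1)] .
    then show "x = y" using xy(3) by blast
  qed
  ultimately show ?thesis by (simp add: ncycles_def ncomp_def card_image)
qed

lemma inj_on_walk_sets: "inj_on (\<lambda>f. set (bwalk G f)) (faces G)"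
proof (rule inj_onI)
  fix f f' assume f: "f \<in> faces G" "f' \<in> faces G" "set (bwalk G f) = set (bwalk G f')"
  obtain g where "g \<in> set (bwalk G f)" using walks(3)[OF f(1)] by (meson list.set_sel(1))
  then show "f = f'" using walk_unique[OF f(1,2)] f(3) by blast
qed

lemma finite_faces: "finite (faces G)"
proof -
  have "(\<lambda>f. set (bwalk G f)) ` faces G \<subseteq> Pow D" using walks(1) by blast
  then have "finite ((\<lambda>f. set (bwalk G f)) ` faces G)"
    using embedding(3) by (meson finite_Pow_iff finite_subset)
  then show ?thesis using inj_on_walk_sets by (rule finite_imageD)
qed

lemma card_faces: "ncycles D (rotate_dart \<circ> reversepath) = card (faces G)"
proof -
  have "D // generated_equiv D (fun_edges D (next_dart G)) = (\<lambda>f. set (bwalk G f)) ` faces G"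
    (is "?L = ?F ` _")
  proof
    show "?L \<subseteq> ?F ` faces G"
    proof
      fix C assume "C \<in> ?L"
      then obtain d where d: "d \<in> D" "C = cycle_of_elem D (next_dart G) d" by (auto elim: quotientE)
      obtain f i where f: "f \<in> faces G" "i < length (bwalk G f)" "bwalk G f ! i = d"
        using walk_exists[OF d(1)] .
      then have "C = ?F f" using face_cycle[OF f(1), of d] d(2) nth_mem by blast
      then show "C \<in> ?F ` faces G" using f(1) by blast
    qed
    show "?F ` faces G \<subseteq> ?L"
    proof
      fix C assume "C \<in> ?F ` faces G"
      then obtain f where f: "f \<in> faces G" "C = ?F f" by blast
      obtain g where g: "g \<in> set (bwalk G f)" using walks(3)[OF f(1)] by (meson list.set_sel(1))
      then have "C = cycle_of_elem D (next_dart G) g" using face_cycle[OF f(1)] f(2) by simp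
      moreover have "g \<in> D" using g walks(1)[OF f(1)] by blast
      ultimately show "C \<in> ?L" by (simp add: quotientI)
    qed
  qed
  then show ?thesis
    unfolding face_perm by (simp add: ncycles_def ncomp_def card_image inj_on_walk_sets)
qed

lemma faces_nonempty: "faces G \<noteq> {}"
proof -
  obtain g where "g \<in> D" using embedding(4) by blast
  then obtain f i where "f \<in> faces G" by (rule walk_exists)
  then show ?thesis by blast
qed

text \<open>Equality of \<open>V + F\<close> and \<open>E + 2\<close> results from the genus bound for combinatorial maps and from the
  lower bound for the number of faces.\<close>

lemma euler_formula:
  "real (ncycles D rotate_dart) + real (ncycles D (rotate_dart \<circ> reversepath)) = real (card D) / 2 + 2"
proof -
  obtain T where T: "T \<subseteq> D" "T \<inter> reversepath ` T = {}" "T \<union> reversepath ` T = D" "2 * card T = card D"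
    by (rule half_darts_exist)
  have supp: "support G = verts G \<union> (\<Union>g\<in>T. path_image g)"
  proof -
    have "(\<Union>g\<in>D. path_image g) = (\<Union>g\<in>T. path_image g)"
      unfolding T(3)[symmetric] by simp
    then show ?thesis by (simp add: support_def)
  qed
  obtain f where f: "f \<in> faces G" using faces_nonempty by blast
  then obtain p where "p \<in> f" unfolding faces_def using in_components_nonempty by blast
  then have p: "p \<in> sphere 0 1" "p \<notin> support G"
    using f unfolding faces_def using in_components_subset by blast+
  have "finite T" using T(1) embedding(3) by (rule finite_subset)
  then have "\<exists>P. separated_in (sphere 0 1 - (verts G \<union> (\<Union>g\<in>T. path_image g))) P \<and>
    1 + card T + ncomp (verts G) ((\<lambda>g. (pathstart g, pathfinish g)) ` T) \<le> card P + card (verts G)"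
  proof (rule faces_lower_bound[OF _ embedding(1,2)])
    show "simple_path g \<and> path_image g \<subseteq> sphere 0 1 \<and> pathstart g \<in> verts G \<and>
      pathfinish g \<in> verts G \<and> g ` {0<..<1} \<inter> verts G = {}" if "g \<in> T" for g
      using that T(1) embedding(6-10) by blast
    show "g ` {0<..<1} \<inter> h ` {0<..<1} = {}" if "g \<in> T" "h \<in> T" "g \<noteq> h" for g h
      using that T(1,2) embedding(12)[of g h] by blast
    show "p \<notin> path_image g" if "g \<in> T" for g
      using p supp that by blast
    show "p \<in> sphere 0 1" "p \<notin> verts G" using p supp by blast+
  qed
  then obtain P where P: "separated_in (sphere 0 1 - support G) P"
    "1 + card T + ncomp (verts G) ((\<lambda>g. (pathstart g, pathfinish g)) ` T) \<le> card P + card (verts G)"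
    unfolding supp by blast
  have "card P \<le> card (faces G)"
    using card_separated_le_components[OF P(1)] finite_faces by (simp add: faces_def)
  moreover have "ncomp (verts G) ((\<lambda>g. (pathstart g, pathfinish g)) ` T) > 0"
  proof (rule ncomp_pos[OF embedding(1)])
    show "verts G \<noteq> {}" using embedding(4,8) by blast
  qed
  ultimately have "2 + card T \<le> card (faces G) + card (verts G)" using P(2) by simp
  moreover have "2 * (card (verts G) + card (faces G)) \<le> card D + 4"
    using euler_genus_bound[OF map_connected embedding(4)] card_vertices card_faces by simp
  ultimately have "2 * (card (verts G) + card (faces G)) = card D + 4" using T(4) by simp
  then have "real (2 * (card (verts G) + card (faces G))) = real (card D + 4)" by simp
  then show ?thesis by (simp add: card_vertices card_faces)
qed

lemma degrees_pos:
  shows "x \<in> verts G \<Longrightarrow> vertex_degree G x > 0" "f \<in> faces G \<Longrightarrow> face_degree G f > 0"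
proof -
  show "vertex_degree G x > 0" if x: "x \<in> verts G"
  proof -
    obtain g where "g \<in> D" "pathstart g = x" using dart_at_vertex[OF x] .
    then have "{g \<in> D. pathstart g = x} \<noteq> {}" by auto
    then show ?thesis using embedding(3) by (simp add: vertex_degree_def card_gt_0_iff)
  qed
  show "face_degree G f > 0" if "f \<in> faces G" using walks(3)[OF that] by (simp add: face_degree_def)
qed

lemma vertex_and_face_degrees:
  assumes kl: "k \<ge> 2" "l \<ge> 2" and x: "x \<in> verts G" and f: "f \<in> faces G"
    and vertices: "\<And>y. y \<in> verts G \<Longrightarrow> y \<noteq> x \<Longrightarrow> vertex_degree G y = k"
    and faces: "\<And>f'. f' \<in> faces G \<Longrightarrow> f' \<noteq> f \<Longrightarrow> face_degree G f' = l"
  shows "real (vertex_degree G x) / real k = real (face_degree G f) / real l"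
    and "k dvd vertex_degree G x \<and> l dvd face_degree G f \<or> k = 3 \<and> l = 3"
proof -
  let ?B = "{g \<in> D. pathstart g = x}" and ?C = "set (bwalk G f)"
  have B: "?B \<subseteq> D" "card ?B = vertex_degree G x" by (auto simp: vertex_degree_def)
  have C: "?C \<subseteq> D" "card ?C = face_degree G f"
    using walks(1,2)[OF f] by (auto simp: face_degree_def distinct_card)
  have vB: "cycle_length D rotate_dart d = vertex_degree G x" if "d \<in> ?B" for d
    using vertex_cycle_length[of d] that by simp
  have vO: "cycle_length D rotate_dart d = k" if "d \<in> D - ?B" for d
    using vertex_cycle_length[of d] vertices[of "pathstart d"] that embedding(8)[of d] by simp
  have fC: "cycle_length D (rotate_dart \<circ> reversepath) d = face_degree G f" if "d \<in> ?C" for d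
    by (rule face_cycle_length[OF f that])
  have fO: "cycle_length D (rotate_dart \<circ> reversepath) d = l" if d: "d \<in> D - ?C" for d
  proof -
    obtain f' i where f': "f' \<in> faces G" "i < length (bwalk G f')" "bwalk G f' ! i = d"
      using walk_exists d by blast
    then have "d \<in> set (bwalk G f')" by auto
    then show ?thesis using face_cycle_length[OF f'(1)] faces[OF f'(1)] d by auto
  qed
  note * = map_connected embedding(4) kl euler_formula B degrees_pos(1)[OF x] vB vO
    C degrees_pos(2)[OF f] fC fO
  show "real (vertex_degree G x) / real k = real (face_degree G f) / real l"
    by (rule vertex_and_face(1)[OF *])
  show "k dvd vertex_degree G x \<and> l dvd face_degree G f \<or> k = 3 \<and> l = 3"
    by (rule vertex_and_face(2)[OF *])
qed

lemma two_face_degrees_equal: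
  assumes kl: "k \<ge> 2" "l \<ge> 2" and f: "f \<in> faces G" and f': "f' \<in> faces G" and ne: "f \<noteq> f'"
    and vertices: "\<And>y. y \<in> verts G \<Longrightarrow> vertex_degree G y = k"
    and faces: "\<And>h. h \<in> faces G \<Longrightarrow> h \<noteq> f \<Longrightarrow> h \<noteq> f' \<Longrightarrow> face_degree G h = l"
  shows "face_degree G f = face_degree G f'"
proof (rule two_faces_equal[OF map_connected embedding(4) kl euler_formula])
  let ?B = "set (bwalk G f)" and ?C = "set (bwalk G f')"
  show "cycle_length D rotate_dart d = k" if "d \<in> D" for d
    using vertex_cycle_length[OF that] vertices embedding(8)[OF that] by simp
  show "?B \<subseteq> D" "?C \<subseteq> D" using walks(1) f f' by blast+
  show "?B \<inter> ?C = {}" using walk_unique[OF f f'] ne by blast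
  show "card ?B = face_degree G f" "card ?C = face_degree G f'"
    using walks(2) f f' by (auto simp: face_degree_def distinct_card)
  show "face_degree G f > 0" "face_degree G f' > 0" using degrees_pos(2) f f' by blast+
  show "cycle_length D (rotate_dart \<circ> reversepath) d = face_degree G f" if "d \<in> ?B" for d
    by (rule face_cycle_length[OF f that])
  show "cycle_length D (rotate_dart \<circ> reversepath) d = face_degree G f'" if "d \<in> ?C" for d
    by (rule face_cycle_length[OF f' that])
  show "cycle_length D (rotate_dart \<circ> reversepath) d = l" if d: "d \<in> D - (?B \<union> ?C)" for d
  proof -
    obtain h i where h: "h \<in> faces G" "i < length (bwalk G h)" "bwalk G h ! i = d"
      using walk_exists d by blast
    then have "d \<in> set (bwalk G h)" by auto
    then show ?thesis using face_cycle_length[OF h(1)] faces[OF h(1)] d by auto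
  qed
qed

end

section \<open>Platonic graphs with exceptions\<close>

text \<open>An arbitrary cell of the other kind, which is regular, serves as the second distinguished
  cell.\<close>

lemma no_1_platonic:
  assumes kl: "k \<ge> 2" "l \<ge> 2"
  shows "\<not> platonic 1 k l G"
proof
  assume P: "platonic 1 k l G"
  interpret plane_graph_map G by standard (use P in \<open>simp add: platonic_def\<close>)
  have fin: "finite (exceptional_vertices k G)" "finite (exceptional_faces l G)"
    and sum: "card (exceptional_vertices k G) + card (exceptional_faces l G) = 1"
    using P by (auto simp: platonic_def)
  consider "card (exceptional_vertices k G) = 1" "card (exceptional_faces l G) = 0"
    | "card (exceptional_vertices k G) = 0" "card (exceptional_faces l G) = 1"
    using sum by linarith
  then show False
  proof cases
    case 1
    then obtain x where ev: "exceptional_vertices k G = {x}" by (auto simp: card_1_singleton_iff)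
    have ef: "exceptional_faces l G = {}" using 1 fin by simp
    have x: "x \<in> verts G" "vertex_degree G x \<noteq> k" using ev by (auto simp: exceptional_vertices_def)
    obtain f where f: "f \<in> faces G" using faces_nonempty by blast
    have "real (vertex_degree G x) / real k = real (face_degree G f) / real l"
      by (rule vertex_and_face_degrees[OF kl x(1) f])
         (use ev ef in \<open>auto simp: exceptional_vertices_def exceptional_faces_def\<close>)
    moreover have "face_degree G f = l" using f ef by (auto simp: exceptional_faces_def)
    ultimately show False using x(2) kl by (simp add: field_simps)
  next
    case 2
    then obtain f where ef: "exceptional_faces l G = {f}" by (auto simp: card_1_singleton_iff)
    have ev: "exceptional_vertices k G = {}" using 2 fin by simp
    have f: "f \<in> faces G" "face_degree G f \<noteq> l" using ef by (auto simp: exceptional_faces_def)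
    obtain x where x: "x \<in> verts G" using embedding(4,8) by blast
    have "real (vertex_degree G x) / real k = real (face_degree G f) / real l"
      by (rule vertex_and_face_degrees[OF kl x f(1)])
         (use ev ef in \<open>auto simp: exceptional_vertices_def exceptional_faces_def\<close>)
    moreover have "vertex_degree G x = k" using x ev by (auto simp: exceptional_vertices_def)
    ultimately show False using f(2) kl by (simp add: field_simps)
  qed
qed

lemma two_exceptional_faces:
  assumes kl: "k \<ge> 2" "l \<ge> 2" and P: "platonic 2 k l G" and ne: "f \<noteq> g"
    and ef: "exceptional_faces l G = {f, g}"
  shows "face_degree G f = face_degree G g"
proof -
  interpret plane_graph_map G by standard (use P in \<open>simp add: platonic_def\<close>)
  have "card (exceptional_vertices k G) = 0" and fin: "finite (exceptional_vertices k G)"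
    using P ne unfolding platonic_def ef by auto
  then have ev: "exceptional_vertices k G = {}" by simp
  have f: "f \<in> faces G" and g: "g \<in> faces G" using ef by (auto simp: exceptional_faces_def)
  show ?thesis
    by (rule two_face_degrees_equal[OF kl f g ne])
       (use ev ef in \<open>auto simp: exceptional_vertices_def exceptional_faces_def\<close>)
qed

lemma exceptional_vertex_and_face:
  assumes kl: "k \<ge> 2" "l \<ge> 2" and P: "platonic 2 k l G"
    and ev: "exceptional_vertices k G = {x}" and ef: "exceptional_faces l G = {f}"
  shows "k = 3 \<and> l = 3 \<and> vertex_degree G x = face_degree G f \<or>
    uniform k l G \<and> real (vertex_degree G x) / real k = real (face_degree G f) / real l"
proof -
  interpret plane_graph_map G by standard (use P in \<open>simp add: platonic_def\<close>)
  have x: "x \<in> verts G" and f: "f \<in> faces G"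
    using ev ef by (auto simp: exceptional_vertices_def exceptional_faces_def)
  have v: "vertex_degree G y = k" if "y \<in> verts G" "y \<noteq> x" for y
    using that ev by (auto simp: exceptional_vertices_def)
  have w: "face_degree G h = l" if "h \<in> faces G" "h \<noteq> f" for h
    using that ef by (auto simp: exceptional_faces_def)
  have eq: "real (vertex_degree G x) / real k = real (face_degree G f) / real l"
    by (rule vertex_and_face_degrees(1)[OF kl x f v w])
  have "k dvd vertex_degree G x \<and> l dvd face_degree G f \<or> k = 3 \<and> l = 3"
    by (rule vertex_and_face_degrees(2)[OF kl x f v w])
  then show ?thesis
  proof
    assume dvd: "k dvd vertex_degree G x \<and> l dvd face_degree G f"
    have "k dvd vertex_degree G y" if "y \<in> verts G" for y
      using dvd v[OF that] by (cases "y = x") auto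
    moreover have "l dvd face_degree G h" if "h \<in> faces G" for h
      using dvd w[OF that] by (cases "h = f") auto
    ultimately have "uniform k l G" using G by (simp add: uniform_def)
    then show ?thesis using eq by blast
  next
    assume "k = 3 \<and> l = 3"
    then show ?thesis using eq by simp
  qed
qed

theorem theorem1p3:
  fixes k l :: nat
  assumes "k \<ge> 2" and "l \<ge> 2"
  shows "(\<nexists>G. platonic 1 k l G) \<and>
    (\<forall>G f g u v. platonic 2 k l G \<and> f \<noteq> g \<and> exceptional_faces l G = {f, g} \<and>
        u = face_degree G f \<and> v = face_degree G g \<longrightarrow> u = v) \<and>
    (\<forall>G x f u v. platonic 2 k l G \<and> exceptional_vertices k G = {x} \<and> exceptional_faces l G = {f} \<and>
        u = vertex_degree G x \<and> v = face_degree G f \<longrightarrow>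
        (k = 3 \<and> l = 3 \<and> u = v) \<or>
        (uniform k l G \<and> real u / real k = real v / real l))"
proof (intro conjI allI impI)
  show "\<nexists>G. platonic 1 k l G" using no_1_platonic[OF assms] by blast
next
  fix G f g u v
  assume "platonic 2 k l G \<and> f \<noteq> g \<and> exceptional_faces l G = {f, g} \<and>
    u = face_degree G f \<and> v = face_degree G g"
  then show "u = v" using two_exceptional_faces[OF assms] by simp
next
  fix G x f u v
  assume "platonic 2 k l G \<and> exceptional_vertices k G = {x} \<and> exceptional_faces l G = {f} \<and>
    u = vertex_degree G x \<and> v = face_degree G f"
  then show "(k = 3 \<and> l = 3 \<and> u = v) \<or> (uniform k l G \<and> real u / real k = real v / real l)"
    using exceptional_vertex_and_face[OF assms] by simp
qed

end
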